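(* For every set of formulas $\Gamma$ and every formula $\phi$, $\Gamma\vdash_{\mathsf{MS^2IC}_u}\phi$ if and only if $\Gamma\vDash_{\mathsf{UMComp}}\phi$, where $\mathsf{UMComp}$ is the class of upper continuous modal compingent algebras.
   Context: Language: propositional variables, $\top,\bot$, $\neg,\wedge,\vee,\to,\leftrightarrow$, a binary connective $\rightsquigarrow$ and a unary modality $\Box$; $\Diamond\phi:=\neg\Box\neg\phi$, $[\forall]\phi:=\top\rightsquigarrow\phi$. $\mathsf{MS^2IC}_u$: theorems are the least set containing all instances of classical tautologies and of (A1) $(\bot\rightsquigarrow\phi)\wedge(\phi\rightsquigarrow\top)$; (A2) $((\phi\vee\psi)\rightsquigarrow\chi)\leftrightarrow((\phi\rightsquigarrow\chi)\wedge(\psi\rightsquigarrow\chi))$; (A3) $(\phi\rightsquigarrow(\psi\wedge\chi))\leftrightarrow((\phi\rightsquigarrow\psi)\wedge(\phi\rightsquigarrow\chi))$; (A4) $(\phi\rightsquigarrow\psi)\to(\phi\to\psi)$; (A5) $(\phi\rightsquigarrow\psi)\leftrightarrow(\neg\psi\rightsquigarrow\neg\phi)$; (A8) $[\forall]\phi\to[\forall][\forall]\phi$; (A9) $\neg[\forall]\phi\to[\forall]\neg[\forall]\phi$; (A10) $(\phi\rightsquigarrow\psi)\leftrightarrow[\forall](\phi\rightsquigarrow\psi)$; (A11) $[\forall]\phi\to(\neg[\forall]\phi\rightsquigarrow\bot)$; (K) $\Box(\phi\to\psi)\to(\Box\phi\to\Box\psi)$; (Add) $(\phi\rightsquigarrow\psi)\to(\Box\phi\rightsquigarrow\Box\psi)$;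 closed under modus ponens, from $\phi$ infer $[\forall]\phi$, from $\phi$ infer $\Box\phi$, and the rules (with $p$ a variable not occurring in $\phi,\psi,\chi$): from $(\phi\rightsquigarrow p)\wedge(p\rightsquigarrow\psi)\to\chi$ infer $(\phi\rightsquigarrow\psi)\to\chi$; from $(p\rightsquigarrow\phi)\wedge p\to\chi$ infer $\phi\to\chi$; from $(p\rightsquigarrow\phi)\wedge\Box p\to\psi$ infer $\Box\phi\to\psi$. $\Gamma\vdash_{\mathsf{MS^2IC}_u}\phi$ means $[\forall](\gamma_1\wedge\dots\wedge\gamma_n)\to\phi$ is a theorem for some $\gamma_1,\dots,\gamma_n\in\Gamma$. A contact algebra is $(B,\prec)$ with $B$ Boolean and $\prec$ satisfying: $0\prec0$, $1\prec1$; $a\prec b,a\prec c\Rightarrow a\prec b\wedge c$; $a\prec c,b\prec c\Rightarrow a\vee b\prec c$; $a\le b\prec c\le d\Rightarrow a\prec d$; $a\prec b\Rightarrow a\le b$; $a\prec b\Rightarrow\neg b\prec\neg a$; compingent if also $a\prec b$ implies $a\prec c\prec b$ for some $c$ and $a\ne0$ implies $b\prec a$ for some $b\neq0$. An upper continuous modal compingent algebra is $(B,\prec,\Diamond)$ with $(B,\prec)$ compingent, $\Diamond$ de Vries additive ($\Diamond0=0$; $a_1\prec b_1,a_2\prec b_2$ imply $\Diamond(a_1\vee a_2)\prec\Diamond b_1\vee\Diamond b_2$) and upper continuous (for each $a$ the meet of $\{\Diamond b:a\prec b\}$ exists and equals $\Diamond a$). A valuation $v$ maps variables into $B$, extends with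 Boolean operations, $v(\phi\rightsquigarrow\psi)=1$ if $v(\phi)\prec v(\psi)$ else $0$, $v(\Box\phi)=\neg\Diamond\neg v(\phi)$. $\Gamma\vDash_{\mathsf{UMComp}}\phi$: for every such algebra and valuation $v$, if $v(\gamma)=1$ for all $\gamma\in\Gamma$ then $v(\phi)=1$.
   Formalization: The calculus has one added rule: from φ↔φ' and ψ↔ψ' infer (φ⇝ψ)↔(φ'⇝ψ'). Without it, with all connectives primitive, the valid formula (p⇝q)→(p⇝¬¬q) is not derivable and completeness fails. *)

theory Defs
  imports "HOL-Algebra.Lattice"
begin

datatype (vars: 'v) form =
    Var 'v
  | Top
  | Bot
  | Neg "'v form"
  | Conj "'v form" "'v form" (infixr \<open>\<^bold>\<and>\<close> 75)
  | Disj "'v form" "'v form" (infixr \<open>\<^bold>\<or>\<close> 74)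
  | Imp "'v form" "'v form" (infixr \<open>\<^bold>\<rightarrow>\<close> 72)
  | Iff "'v form" "'v form" (infix \<open>\<^bold>\<leftrightarrow>\<close> 71)
  | SImp "'v form" "'v form" (infix \<open>\<leadsto>\<close> 76)
  | Box "'v form"

type_synonym fm = "nat form"

abbreviation All :: "fm \<Rightarrow> fm" where
  "All \<phi> \<equiv> Top \<leadsto> \<phi>"

datatype cform =
    CVar nat
  | CTop
  | CBot
  | CNeg cform
  | CConj cform cform
  | CDisj cform cform
  | CImp cform cform
  | CIff cform cform

primrec truth :: "(nat \<Rightarrow> bool) \<Rightarrow> cform \<Rightarrow> bool" where
  "truth e (CVar n) \<longleftrightarrow> e n"
| "truth e CTop \<longleftrightarrow> True"
| "truth e CBot \<longleftrightarrow> False"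
| "truth e (CNeg \<alpha>) \<longleftrightarrow> \<not> truth e \<alpha>"
| "truth e (CConj \<alpha> \<beta>) \<longleftrightarrow> truth e \<alpha> \<and> truth e \<beta>"
| "truth e (CDisj \<alpha> \<beta>) \<longleftrightarrow> truth e \<alpha> \<or> truth e \<beta>"
| "truth e (CImp \<alpha> \<beta>) \<longleftrightarrow> (truth e \<alpha> \<longrightarrow> truth e \<beta>)"
| "truth e (CIff \<alpha> \<beta>) \<longleftrightarrow> (truth e \<alpha> \<longleftrightarrow> truth e \<beta>)"

definition tautology :: "cform \<Rightarrow> bool" where
  "tautology \<alpha> \<longleftrightarrow> (\<forall>e. truth e \<alpha>)"

primrec inst :: "(nat \<Rightarrow> fm) \<Rightarrow> cform \<Rightarrow> fm" where
  "inst \<sigma> (CVar n) = \<sigma> n"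
| "inst \<sigma> CTop = Top"
| "inst \<sigma> CBot = Bot"
| "inst \<sigma> (CNeg \<alpha>) = Neg (inst \<sigma> \<alpha>)"
| "inst \<sigma> (CConj \<alpha> \<beta>) = inst \<sigma> \<alpha> \<^bold>\<and> inst \<sigma> \<beta>"
| "inst \<sigma> (CDisj \<alpha> \<beta>) = inst \<sigma> \<alpha> \<^bold>\<or> inst \<sigma> \<beta>"
| "inst \<sigma> (CImp \<alpha> \<beta>) = inst \<sigma> \<alpha> \<^bold>\<rightarrow> inst \<sigma> \<beta>"
| "inst \<sigma> (CIff \<alpha> \<beta>) = inst \<sigma> \<alpha> \<^bold>\<leftrightarrow> inst \<sigma> \<beta>"

text \<open>
  The rule \<open>Repl\<close> makes explicit that provably equivalent formulas may replace one another as
  arguments of \<open>\<leadsto>\<close>, as the Lindenbaum-Tarski construction presupposes. It does not follow from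
  the remaining clauses when all connectives are primitive: without it
  \<open>(p \<leadsto> q) \<^bold>\<rightarrow> (p \<leadsto> Neg (Neg q))\<close>, which is valid in every contact algebra, is underivable.
  (Let \<open>Box\<close> be the identity on truth values, and let \<open>\<phi> \<leadsto> \<psi>\<close> be evaluated by decomposing
  disjunctions in \<open>\<phi>\<close>, conjunctions in \<open>\<psi>\<close>, and pairs of negations or boxes, leaving only the
  instances fixed by (A1), (A10) and (A11) and otherwise an arbitrary relation on pairs of
  formulas that respects truth values; everything below except \<open>Repl\<close> is sound for this.)
  Replacement under \<open>Box\<close> and under the Boolean connectives is derivable.
\<close>

inductive ms2icu :: "fm \<Rightarrow> bool" where
  Taut: "tautology \<alpha> \<Longrightarrow> ms2icu (inst \<sigma> \<alpha>)"
| A1: "ms2icu ((Bot \<leadsto> \<phi>) \<^bold>\<and> (\<phi> \<leadsto> Top))"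
| A2: "ms2icu (((\<phi> \<^bold>\<or> \<psi>) \<leadsto> \<chi>) \<^bold>\<leftrightarrow> ((\<phi> \<leadsto> \<chi>) \<^bold>\<and> (\<psi> \<leadsto> \<chi>)))"
| A3: "ms2icu ((\<phi> \<leadsto> (\<psi> \<^bold>\<and> \<chi>)) \<^bold>\<leftrightarrow> ((\<phi> \<leadsto> \<psi>) \<^bold>\<and> (\<phi> \<leadsto> \<chi>)))"
| A4: "ms2icu ((\<phi> \<leadsto> \<psi>) \<^bold>\<rightarrow> (\<phi> \<^bold>\<rightarrow> \<psi>))"
| A5: "ms2icu ((\<phi> \<leadsto> \<psi>) \<^bold>\<leftrightarrow> (Neg \<psi> \<leadsto> Neg \<phi>))"
| A8: "ms2icu (All \<phi> \<^bold>\<rightarrow> All (All \<phi>))"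
| A9: "ms2icu (Neg (All \<phi>) \<^bold>\<rightarrow> All (Neg (All \<phi>)))"
| A10: "ms2icu ((\<phi> \<leadsto> \<psi>) \<^bold>\<leftrightarrow> All (\<phi> \<leadsto> \<psi>))"
| A11: "ms2icu (All \<phi> \<^bold>\<rightarrow> (Neg (All \<phi>) \<leadsto> Bot))"
| K: "ms2icu (Box (\<phi> \<^bold>\<rightarrow> \<psi>) \<^bold>\<rightarrow> (Box \<phi> \<^bold>\<rightarrow> Box \<psi>))"
| Add: "ms2icu ((\<phi> \<leadsto> \<psi>) \<^bold>\<rightarrow> (Box \<phi> \<leadsto> Box \<psi>))"
| Repl: "\<lbrakk>ms2icu (\<phi> \<^bold>\<leftrightarrow> \<phi>'); ms2icu (\<psi> \<^bold>\<leftrightarrow> \<psi>')\<rbrakk> \<Longrightarrow> ms2icu ((\<phi> \<leadsto> \<psi>) \<^bold>\<leftrightarrow> (\<phi>' \<leadsto> \<psi>'))"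
| MP: "\<lbrakk>ms2icu (\<phi> \<^bold>\<rightarrow> \<psi>); ms2icu \<phi>\<rbrakk> \<Longrightarrow> ms2icu \<psi>"
| NecAll: "ms2icu \<phi> \<Longrightarrow> ms2icu (All \<phi>)"
| NecBox: "ms2icu \<phi> \<Longrightarrow> ms2icu (Box \<phi>)"
| Interpolate:
    "\<lbrakk>ms2icu ((\<phi> \<leadsto> Var p) \<^bold>\<and> (Var p \<leadsto> \<psi>) \<^bold>\<rightarrow> \<chi>); p \<notin> vars \<phi> \<union> vars \<psi> \<union> vars \<chi>\<rbrakk>
      \<Longrightarrow> ms2icu ((\<phi> \<leadsto> \<psi>) \<^bold>\<rightarrow> \<chi>)"
| Approximate:
    "\<lbrakk>ms2icu ((Var p \<leadsto> \<phi>) \<^bold>\<and> Var p \<^bold>\<rightarrow> \<chi>); p \<notin> vars \<phi> \<union> vars \<chi>\<rbrakk>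
      \<Longrightarrow> ms2icu (\<phi> \<^bold>\<rightarrow> \<chi>)"
| Continuous:
    "\<lbrakk>ms2icu ((Var p \<leadsto> \<phi>) \<^bold>\<and> Box (Var p) \<^bold>\<rightarrow> \<psi>); p \<notin> vars \<phi> \<union> vars \<psi>\<rbrakk>
      \<Longrightarrow> ms2icu (Box \<phi> \<^bold>\<rightarrow> \<psi>)"

fun conjs :: "fm list \<Rightarrow> fm" where
  "conjs [] = Top"
| "conjs [\<gamma>] = \<gamma>"
| "conjs (\<gamma> # \<gamma>s) = \<gamma> \<^bold>\<and> conjs \<gamma>s"

definition derives :: "fm set \<Rightarrow> fm \<Rightarrow> bool" (infix \<open>\<turnstile>\<^sub>M\<^sub>S\<close> 50) where
  "\<Gamma> \<turnstile>\<^sub>M\<^sub>S \<phi> \<longleftrightarrow> (\<exists>\<gamma>s. set \<gamma>s \<subseteq> \<Gamma> \<and> ms2icu (All (conjs \<gamma>s) \<^bold>\<rightarrow> \<phi>))"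

locale boolean_lattice = bounded_lattice L for L (structure) +
  assumes meet_join_distrib:
      "\<lbrakk>x \<in> carrier L; y \<in> carrier L; z \<in> carrier L\<rbrakk> \<Longrightarrow> x \<sqinter> (y \<squnion> z) = (x \<sqinter> y) \<squnion> (x \<sqinter> z)"
    and complement_exists:
      "x \<in> carrier L \<Longrightarrow> \<exists>y\<in>carrier L. x \<sqinter> y = \<bottom> \<and> x \<squnion> y = \<top>"

definition complement :: "('a, 'b) gorder_scheme \<Rightarrow> 'a \<Rightarrow> 'a" (\<open>\<sim>\<index> _\<close> [81] 80) where
  "\<sim>\<^bsub>L\<^esub> x = (THE y. y \<in> carrier L \<and> x \<sqinter>\<^bsub>L\<^esub> y = \<bottom>\<^bsub>L\<^esub> \<and> x \<squnion>\<^bsub>L\<^esub> y = \<top>\<^bsub>L\<^esub>)"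

record 'a contact_structure = "'a gorder" +
  prec :: "'a \<Rightarrow> 'a \<Rightarrow> bool" (infix \<open>\<prec>\<index>\<close> 50)

record 'a modal_contact_structure = "'a contact_structure" +
  dia :: "'a \<Rightarrow> 'a" (\<open>\<diamondsuit>\<index> _\<close> [81] 80)

locale contact_algebra = boolean_lattice L for L (structure) +
  assumes prec_bottom: "\<bottom> \<prec> \<bottom>"
    and prec_top: "\<top> \<prec> \<top>"
    and prec_meet: "\<lbrakk>a \<in> carrier L; b \<in> carrier L; c \<in> carrier L; a \<prec> b; a \<prec> c\<rbrakk> \<Longrightarrow> a \<prec> b \<sqinter> c"
    and prec_join: "\<lbrakk>a \<in> carrier L; b \<in> carrier L; c \<in> carrier L; a \<prec> c; b \<prec> c\<rbrakk> \<Longrightarrow> a \<squnion> b \<prec> c"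
    and prec_mono: "\<lbrakk>a \<in> carrier L; b \<in> carrier L; c \<in> carrier L; d \<in> carrier L;
      a \<sqsubseteq> b; b \<prec> c; c \<sqsubseteq> d\<rbrakk> \<Longrightarrow> a \<prec> d"
    and prec_imp_le: "\<lbrakk>a \<in> carrier L; b \<in> carrier L; a \<prec> b\<rbrakk> \<Longrightarrow> a \<sqsubseteq> b"
    and prec_complement: "\<lbrakk>a \<in> carrier L; b \<in> carrier L; a \<prec> b\<rbrakk> \<Longrightarrow> \<sim> b \<prec> \<sim> a"

locale compingent_algebra = contact_algebra +
  assumes prec_interpolate:
      "\<lbrakk>a \<in> carrier L; b \<in> carrier L; a \<prec> b\<rbrakk> \<Longrightarrow> \<exists>c\<in>carrier L. a \<prec> c \<and> c \<prec> b"
    and prec_approximate: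
      "\<lbrakk>a \<in> carrier L; a \<noteq> \<bottom>\<rbrakk> \<Longrightarrow> \<exists>b\<in>carrier L. b \<noteq> \<bottom> \<and> b \<prec> a"

locale umcomp_algebra = compingent_algebra L
  for L :: "('a, 'b) modal_contact_structure_scheme" (structure) +
  assumes dia_closed: "a \<in> carrier L \<Longrightarrow> \<diamondsuit> a \<in> carrier L"
    and dia_bottom: "\<diamondsuit> \<bottom> = \<bottom>"
    and dia_additive: "\<lbrakk>a\<^sub>1 \<in> carrier L; b\<^sub>1 \<in> carrier L; a\<^sub>2 \<in> carrier L; b\<^sub>2 \<in> carrier L;
      a\<^sub>1 \<prec> b\<^sub>1; a\<^sub>2 \<prec> b\<^sub>2\<rbrakk> \<Longrightarrow> \<diamondsuit> (a\<^sub>1 \<squnion> a\<^sub>2) \<prec> \<diamondsuit> b\<^sub>1 \<squnion> \<diamondsuit> b\<^sub>2"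
    and dia_upper_continuous:
      "a \<in> carrier L \<Longrightarrow> greatest L (\<diamondsuit> a) (Lower L {\<diamondsuit> b | b. b \<in> carrier L \<and> a \<prec> b})"

primrec eval_fm :: "('a, 'b) modal_contact_structure_scheme \<Rightarrow> (nat \<Rightarrow> 'a) \<Rightarrow> fm \<Rightarrow> 'a" where
  "eval_fm L v (Var n) = v n"
| "eval_fm L v Top = \<top>\<^bsub>L\<^esub>"
| "eval_fm L v Bot = \<bottom>\<^bsub>L\<^esub>"
| "eval_fm L v (Neg \<phi>) = \<sim>\<^bsub>L\<^esub> eval_fm L v \<phi>"
| "eval_fm L v (\<phi> \<^bold>\<and> \<psi>) = eval_fm L v \<phi> \<sqinter>\<^bsub>L\<^esub> eval_fm L v \<psi>"
| "eval_fm L v (\<phi> \<^bold>\<or> \<psi>) = eval_fm L v \<phi> \<squnion>\<^bsub>L\<^esub> eval_fm L v \<psi>"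
| "eval_fm L v (\<phi> \<^bold>\<rightarrow> \<psi>) = (\<sim>\<^bsub>L\<^esub> eval_fm L v \<phi>) \<squnion>\<^bsub>L\<^esub> eval_fm L v \<psi>"
| "eval_fm L v (\<phi> \<^bold>\<leftrightarrow> \<psi>) =
    ((\<sim>\<^bsub>L\<^esub> eval_fm L v \<phi>) \<squnion>\<^bsub>L\<^esub> eval_fm L v \<psi>) \<sqinter>\<^bsub>L\<^esub> ((\<sim>\<^bsub>L\<^esub> eval_fm L v \<psi>) \<squnion>\<^bsub>L\<^esub> eval_fm L v \<phi>)"
| "eval_fm L v (\<phi> \<leadsto> \<psi>) = (if eval_fm L v \<phi> \<prec>\<^bsub>L\<^esub> eval_fm L v \<psi> then \<top>\<^bsub>L\<^esub> else \<bottom>\<^bsub>L\<^esub>)"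
| "eval_fm L v (Box \<phi>) = \<sim>\<^bsub>L\<^esub> (\<diamondsuit>\<^bsub>L\<^esub> (\<sim>\<^bsub>L\<^esub> eval_fm L v \<phi>))"

text \<open>
  Semantic consequence over the algebras whose carrier is a subset of the type \<open>'a\<close>. HOL cannot
  quantify over types inside a formula, so the ambient universe is a parameter; every algebra
  lives in some infinite type (finite algebras as proper subsets).
\<close>

definition umcomp_consequence :: "'a itself \<Rightarrow> fm set \<Rightarrow> fm \<Rightarrow> bool" where
  "umcomp_consequence _ \<Gamma> \<phi> \<longleftrightarrow>
    (\<forall>(L :: 'a modal_contact_structure) v. umcomp_algebra L \<longrightarrow> range v \<subseteq> carrier L \<longrightarrow>
      (\<forall>\<gamma>\<in>\<Gamma>. eval_fm L v \<gamma> = \<top>\<^bsub>L\<^esub>) \<longrightarrow> eval_fm L v \<phi> = \<top>\<^bsub>L\<^esub>)"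

end

theory Submission
  imports Defs "HOL-Library.Countable"
begin

text \<open>
  Soundness is checked at the ultrafilters of an algebra, where the Boolean connectives become truth
  tables. For completeness, the three rules with a fresh variable say that witnesses for
  interpolation, approximation and upper continuity can be added to a theory without deriving new
  formulas in the old variables. Extending a theory that does not derive \<open>\<phi>\<close> to a maximal one with
  witnesses decides every strict implication, so its Lindenbaum algebra is an upper continuous modal
  compingent algebra in which \<open>\<leadsto>\<close> takes only the values 0 and 1. That algebra is countable and
  hence embeds into any infinite type.
\<close>

section \<open>Propositional reasoning inside the calculus\<close>

text \<open>Consequence is global: premises may be necessitated, so discharging \<delta> gives only
  an implication from \<open>All \<delta>\<close>. Formulas that imply their own \<open>All\<close>
  closure escape this restriction; by (A9) and (A10) they include strict implications and their
  negations. This shapes the Henkin construction: a failing inclusion is recorded as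
  \<open>Neg (All _)\<close>, and consistency is measured against \<open>All \<phi>\<close>, whose
  negation can be carried under \<open>All\<close>. The maximal theory must remain closed under
  necessitation, so it is asked to decide strict implications only; deciding every formula would
  collapse the Lindenbaum algebra to at most two elements. On the semantic side the obstacle is (K).
  The operator is assumed additive only up to \<prec>, and its monotonicity and subadditivity for
  the order have to be recovered from upper continuity.\<close>

instance form :: (countable) countable
  by countable_datatype

lemma finite_vars: "finite (vars \<phi>)"
  by (induct \<phi>) auto

text \<open>Variables, strict implications and boxed formulas count as atoms. Tautologies can then
  be certified by the simplifier on the formula itself, without exhibiting a schema in
  \<open>cform\<close>.\<close>

primrec bval :: "(fm \<Rightarrow> bool) \<Rightarrow> fm \<Rightarrow> bool" where
  "bval e (Var n) \<longleftrightarrow> e (Var n)"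
| "bval e Top \<longleftrightarrow> True"
| "bval e Bot \<longleftrightarrow> False"
| "bval e (Neg \<phi>) \<longleftrightarrow> \<not> bval e \<phi>"
| "bval e (\<phi> \<^bold>\<and> \<psi>) \<longleftrightarrow> bval e \<phi> \<and> bval e \<psi>"
| "bval e (\<phi> \<^bold>\<or> \<psi>) \<longleftrightarrow> bval e \<phi> \<or> bval e \<psi>"
| "bval e (\<phi> \<^bold>\<rightarrow> \<psi>) \<longleftrightarrow> (bval e \<phi> \<longrightarrow> bval e \<psi>)"
| "bval e (\<phi> \<^bold>\<leftrightarrow> \<psi>) \<longleftrightarrow> (bval e \<phi> \<longleftrightarrow> bval e \<psi>)"
| "bval e (\<phi> \<leadsto> \<psi>) \<longleftrightarrow> e (\<phi> \<leadsto> \<psi>)"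
| "bval e (Box \<phi>) \<longleftrightarrow> e (Box \<phi>)"

text \<open>Each atom is named by its own code, so the single substitution \<open>from_nat\<close>
  recovers the formula from its schema.\<close>

primrec skeleton :: "fm \<Rightarrow> cform" where
  "skeleton (Var n) = CVar (to_nat (Var n :: fm))"
| "skeleton Top = CTop"
| "skeleton Bot = CBot"
| "skeleton (Neg \<phi>) = CNeg (skeleton \<phi>)"
| "skeleton (\<phi> \<^bold>\<and> \<psi>) = CConj (skeleton \<phi>) (skeleton \<psi>)"
| "skeleton (\<phi> \<^bold>\<or> \<psi>) = CDisj (skeleton \<phi>) (skeleton \<psi>)"
| "skeleton (\<phi> \<^bold>\<rightarrow> \<psi>) = CImp (skeleton \<phi>) (skeleton \<psi>)"
| "skeleton (\<phi> \<^bold>\<leftrightarrow> \<psi>) = CIff (skeleton \<phi>) (skeleton \<psi>)"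
| "skeleton (\<phi> \<leadsto> \<psi>) = CVar (to_nat (\<phi> \<leadsto> \<psi>))"
| "skeleton (Box \<phi>) = CVar (to_nat (Box \<phi>))"

lemma inst_skeleton: "inst from_nat (skeleton \<phi>) = \<phi>"
  by (induct \<phi>) simp_all

lemma truth_skeleton: "truth e (skeleton \<phi>) = bval (\<lambda>\<psi>. e (to_nat \<psi>)) \<phi>"
  by (induct \<phi>) simp_all

lemma ms2icu_taut:
  assumes "\<And>e. bval e \<phi>"
  shows "ms2icu \<phi>"
proof -
  have "tautology (skeleton \<phi>)"
    using assms by (simp add: tautology_def truth_skeleton)
  then show ?thesis
    using ms2icu.Taut[of "skeleton \<phi>" from_nat] by (simp add: inst_skeleton)
qed

lemma bval_conjs: "bval e (conjs \<gamma>s) \<longleftrightarrow> (\<forall>\<gamma>\<in>set \<gamma>s. bval e \<gamma>)"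
  by (induct \<gamma>s rule: conjs.induct) auto

section \<open>Theories closed under global consequence\<close>

text \<open>Shared interface of the calculus itself, of consequence from a set of premises and of
  saturated theories. Necessitation for \<open>Box\<close> is not among the assumptions because it
  follows through (Add).\<close>

locale normal_theory =
  fixes P :: "fm \<Rightarrow> bool"
  assumes ax: "ms2icu \<phi> \<Longrightarrow> P \<phi>"
    and mp: "\<lbrakk>P (\<phi> \<^bold>\<rightarrow> \<psi>); P \<phi>\<rbrakk> \<Longrightarrow> P \<psi>"
    and nec: "P \<phi> \<Longrightarrow> P (All \<phi>)"
begin

lemma taut: "(\<And>e. bval e \<phi>) \<Longrightarrow> P \<phi>"
  by (rule ax, rule ms2icu_taut)

text \<open>This and its variants with more premises reduce an inference in the theory to a
  truth-table check with \<open>bval\<close>.\<close>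

lemma prop1: "\<lbrakk>P a; \<And>e. bval e a \<Longrightarrow> bval e b\<rbrakk> \<Longrightarrow> P b"
  by (rule mp[OF taut, of a]) simp_all

lemma prop2: "\<lbrakk>P a; P b; \<And>e. \<lbrakk>bval e a; bval e b\<rbrakk> \<Longrightarrow> bval e c\<rbrakk> \<Longrightarrow> P c"
  by (rule mp[OF prop1, of a b]) simp_all

lemma prop3: "\<lbrakk>P a; P b; P c; \<And>e. \<lbrakk>bval e a; bval e b; bval e c\<rbrakk> \<Longrightarrow> bval e d\<rbrakk> \<Longrightarrow> P d"
  by (rule mp[OF prop2, of a b c]) simp_all

lemma all_elim: "P (All \<phi>) \<Longrightarrow> P \<phi>"
  by (rule prop2[OF ax[OF ms2icu.A4[of Top \<phi>]], of "All \<phi>"]) auto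

text \<open>The equivalences are required in the calculus and not merely in \<open>P\<close>,
  because \<open>Repl\<close> is a rule about theorems. Equivalences of \<open>P\<close> are handled
  by the monotonicity lemmas below.\<close>

lemma iff_cong_simp:
  assumes "P (a \<leadsto> b)" "ms2icu (a \<^bold>\<leftrightarrow> a')" "ms2icu (b \<^bold>\<leftrightarrow> b')"
  shows "P (a' \<leadsto> b')"
  by (rule prop2[OF assms(1) ax[OF ms2icu.Repl[OF assms(2,3)]]]) simp

lemma taut_cong_simp:
  assumes "P (a \<leadsto> b)" "\<And>e. bval e a = bval e a'" "\<And>e. bval e b = bval e b'"
  shows "P (a' \<leadsto> b')"
  using assms by (intro iff_cong_simp[OF assms(1)] ms2icu_taut) simp_all

lemma simp_conj_iff: "P (a \<leadsto> (b \<^bold>\<and> c)) \<longleftrightarrow> P (a \<leadsto> b) \<and> P (a \<leadsto> c)"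
proof -
  have *: "P ((a \<leadsto> (b \<^bold>\<and> c)) \<^bold>\<leftrightarrow> (a \<leadsto> b) \<^bold>\<and> (a \<leadsto> c))"
    by (rule ax[OF ms2icu.A3])
  show ?thesis
    by (intro iffI conjI; (elim conjE)?;
        rule prop2[OF *, of "a \<leadsto> (b \<^bold>\<and> c)"] prop3[OF *, of "a \<leadsto> b" "a \<leadsto> c"]; simp)
qed

lemma simp_disj_iff: "P ((a \<^bold>\<or> b) \<leadsto> c) \<longleftrightarrow> P (a \<leadsto> c) \<and> P (b \<leadsto> c)"
proof -
  have *: "P (((a \<^bold>\<or> b) \<leadsto> c) \<^bold>\<leftrightarrow> (a \<leadsto> c) \<^bold>\<and> (b \<leadsto> c))"
    by (rule ax[OF ms2icu.A2])
  show ?thesis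
    by (intro iffI conjI; (elim conjE)?;
        rule prop2[OF *, of "(a \<^bold>\<or> b) \<leadsto> c"] prop3[OF *, of "a \<leadsto> c" "b \<leadsto> c"]; simp)
qed

lemma simp_neg: "P (a \<leadsto> b) \<Longrightarrow> P (Neg b \<leadsto> Neg a)"
  by (rule prop2[OF ax[OF ms2icu.A5[of a b]]]) auto

lemma simp_imp: "P (a \<leadsto> b) \<Longrightarrow> P (a \<^bold>\<rightarrow> b)"
  by (rule prop2[OF ax[OF ms2icu.A4[of a b]]]) auto

lemma bot_simp: "P (Bot \<leadsto> a)" and simp_top: "P (a \<leadsto> Top)"
  by (rule prop1[OF ax[OF ms2icu.A1[of a]]], simp)+

text \<open>Necessitating the implication and contraposing puts the difference of \<open>a\<close>
  and \<open>b\<close> strictly below \<open>Bot\<close>, hence below \<open>c\<close>. By (A2) it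
  can be joined with \<open>b\<close>, and the join lies above \<open>a\<close>.\<close>

lemma simp_left_mono:
  assumes ab: "P (a \<^bold>\<rightarrow> b)" and bc: "P (b \<leadsto> c)"
  shows "P (a \<leadsto> c)"
proof -
  have "P (Neg (a \<^bold>\<rightarrow> b) \<leadsto> Neg Top)"
    by (rule simp_neg[OF nec[OF ab]])
  \<comment> \<open>Writing \<open>Bot\<close> as a conjunction with \<open>c\<close> lets (A3)
    weaken the right-hand side to \<open>c\<close>.\<close>
  then have "P ((a \<^bold>\<and> Neg b) \<leadsto> (Bot \<^bold>\<and> c))"
    by (rule taut_cong_simp) auto
  then have "P ((a \<^bold>\<and> Neg b) \<leadsto> c)"
    by (simp add: simp_conj_iff)
  with bc have "P (((a \<^bold>\<and> Neg b) \<^bold>\<or> b) \<leadsto> c)"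
    by (simp add: simp_disj_iff)
  then have "P ((a \<^bold>\<or> b) \<leadsto> c)"
    by (rule taut_cong_simp) auto
  then show ?thesis
    by (simp add: simp_disj_iff)
qed

lemma simp_right_mono:
  assumes ab: "P (a \<leadsto> b)" and bc: "P (b \<^bold>\<rightarrow> c)"
  shows "P (a \<leadsto> c)"
proof -
  have "P (Neg c \<^bold>\<rightarrow> Neg b)"
    by (rule prop1[OF bc]) auto
  then have "P (Neg c \<leadsto> Neg a)"
    by (rule simp_left_mono) (rule simp_neg[OF ab])
  then have "P (Neg (Neg a) \<leadsto> Neg (Neg c))"
    by (rule simp_neg)
  then show ?thesis
    by (rule taut_cong_simp) auto
qed

text \<open>(Add) carries \<open>Top \<leadsto> a\<close> to
  \<open>Box Top \<leadsto> Box a\<close>, and \<open>Box Top\<close> is a theorem.\<close>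

lemma nec_box:
  assumes "P a"
  shows "P (Box a)"
proof -
  have "ms2icu (Box Top)"
    by (rule ms2icu.NecBox, rule ms2icu_taut) simp
  then have top: "P (Box Top)"
    by (rule ax)
  have "P (Box Top \<leadsto> Box a)"
    by (rule mp[OF ax[OF ms2icu.Add] nec[OF assms]])
  from mp[OF simp_imp[OF this] top] show ?thesis .
qed

lemma box_mono: "P (a \<^bold>\<rightarrow> b) \<Longrightarrow> P (Box a \<^bold>\<rightarrow> Box b)"
  by (rule mp[OF ax[OF ms2icu.K] nec_box])

end

section \<open>Formulas that imply their own universal closure\<close>

interpretation ms: normal_theory ms2icu
  by unfold_locales (assumption | fact ms2icu.MP ms2icu.NecAll)+

text \<open>The conclusion is an implication inside the calculus, so necessitation alone does not
  give it. Replacing \<open>a\<close> by its conjunction with \<open>b\<close> turns the claim into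
  (A3).\<close>

lemma ms2icu_all_mono:
  assumes "ms2icu (a \<^bold>\<rightarrow> b)"
  shows "ms2icu (All a \<^bold>\<rightarrow> All b)"
proof -
  have "ms2icu (a \<^bold>\<leftrightarrow> a \<^bold>\<and> b)"
    by (rule ms.prop1[OF assms]) auto
  moreover have "ms2icu (Top \<^bold>\<leftrightarrow> Top)"
    by (rule ms2icu_taut) simp
  ultimately have "ms2icu (All a \<^bold>\<leftrightarrow> All (a \<^bold>\<and> b))"
    by (intro ms2icu.Repl)
  then show ?thesis
    by (rule ms.prop2[OF _ ms2icu.A3[of Top a b]]) auto
qed

lemma ms2icu_all_conj: "ms2icu (All (a \<^bold>\<and> b) \<^bold>\<leftrightarrow> All a \<^bold>\<and> All b)"
  by (rule ms2icu.A3)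

text \<open>Semantically, such a formula takes only the values 0 and 1. As a premise it can be
  discharged without an \<open>All\<close> in front.\<close>

definition global :: "fm \<Rightarrow> bool" where
  "global \<phi> \<longleftrightarrow> ms2icu (\<phi> \<^bold>\<rightarrow> All \<phi>)"

lemma global_simp: "global (\<phi> \<leadsto> \<psi>)"
  unfolding global_def by (rule ms.prop1[OF ms2icu.A10[of \<phi> \<psi>]]) auto

text \<open>(A9) speaks of negated \<open>All\<close> formulas; (A10) identifies a strict
  implication with its \<open>All\<close> closure, which transfers (A9) to its negation.\<close>

lemma global_neg_simp: "global (Neg (\<phi> \<leadsto> \<psi>))"
proof -
  let ?g = "\<phi> \<leadsto> \<psi>"
  have "ms2icu (Neg (All ?g) \<^bold>\<rightarrow> Neg ?g)"
    by (rule ms.prop1[OF ms2icu.A10[of \<phi> \<psi>]]) auto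
  then have "ms2icu (All (Neg (All ?g)) \<^bold>\<rightarrow> All (Neg ?g))"
    by (rule ms2icu_all_mono)
  then show ?thesis
    unfolding global_def by (rule ms.prop3[OF _ ms2icu.A9[of ?g] ms2icu.A10[of \<phi> \<psi>]]) auto
qed

lemma global_conj: "\<lbrakk>global a; global b\<rbrakk> \<Longrightarrow> global (a \<^bold>\<and> b)"
  unfolding global_def by (rule ms.prop3[OF _ _ ms2icu_all_conj[of a b], of "a \<^bold>\<rightarrow> All a" "b \<^bold>\<rightarrow> All b"]) auto

lemma global_lift:
  assumes "global a" "ms2icu (a \<^bold>\<rightarrow> b)"
  shows "ms2icu (a \<^bold>\<rightarrow> All b)"
  by (rule ms.prop2[OF assms(1)[unfolded global_def] ms2icu_all_mono[OF assms(2)]]) auto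

section \<open>Global consequence as a normal theory, and its deduction theorem\<close>

lemma derives_ax:
  assumes "ms2icu \<phi>"
  shows "\<Gamma> \<turnstile>\<^sub>M\<^sub>S \<phi>"
proof -
  have "ms2icu (All (conjs []) \<^bold>\<rightarrow> \<phi>)"
    by (rule ms.prop1[OF assms]) simp
  then show ?thesis
    unfolding derives_def by (intro exI[of _ "[]"]) simp
qed

lemma derives_mono: "\<lbrakk>\<Gamma> \<turnstile>\<^sub>M\<^sub>S \<phi>; \<Gamma> \<subseteq> \<Delta>\<rbrakk> \<Longrightarrow> \<Delta> \<turnstile>\<^sub>M\<^sub>S \<phi>"
  unfolding derives_def by blast

lemma ms2icu_all_conjs_mono:
  "set \<gamma>s \<subseteq> set \<delta>s \<Longrightarrow> ms2icu (All (conjs \<delta>s) \<^bold>\<rightarrow> All (conjs \<gamma>s))"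
  by (rule ms2icu_all_mono, rule ms2icu_taut) (auto simp: bval_conjs)

lemma derives_in:
  assumes "\<gamma> \<in> \<Gamma>"
  shows "\<Gamma> \<turnstile>\<^sub>M\<^sub>S \<gamma>"
proof -
  have "ms2icu (All (conjs [\<gamma>]) \<^bold>\<rightarrow> \<gamma>)"
    by (rule ms.prop1[OF ms2icu.A4[of Top \<gamma>]]) simp
  then show ?thesis
    using assms unfolding derives_def by (intro exI[of _ "[\<gamma>]"]) simp
qed

lemma derives_mp:
  assumes "\<Gamma> \<turnstile>\<^sub>M\<^sub>S \<phi> \<^bold>\<rightarrow> \<psi>" "\<Gamma> \<turnstile>\<^sub>M\<^sub>S \<phi>"
  shows "\<Gamma> \<turnstile>\<^sub>M\<^sub>S \<psi>"
proof -
  obtain \<gamma>s \<delta>s where s: "set \<gamma>s \<subseteq> \<Gamma>" "set \<delta>s \<subseteq> \<Gamma>"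
    and d: "ms2icu (All (conjs \<gamma>s) \<^bold>\<rightarrow> (\<phi> \<^bold>\<rightarrow> \<psi>))" "ms2icu (All (conjs \<delta>s) \<^bold>\<rightarrow> \<phi>)"
    using assms unfolding derives_def by blast
  let ?c = "All (conjs (\<gamma>s @ \<delta>s))"
  have "ms2icu (?c \<^bold>\<rightarrow> (\<phi> \<^bold>\<rightarrow> \<psi>))"
    by (rule ms.prop2[OF d(1) ms2icu_all_conjs_mono[of \<gamma>s "\<gamma>s @ \<delta>s"]]) auto
  moreover have "ms2icu (?c \<^bold>\<rightarrow> \<phi>)"
    by (rule ms.prop2[OF d(2) ms2icu_all_conjs_mono[of \<delta>s "\<gamma>s @ \<delta>s"]]) auto
  ultimately have "ms2icu (?c \<^bold>\<rightarrow> \<psi>)"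
    by (rule ms.prop2) auto
  then show ?thesis
    using s unfolding derives_def by (intro exI[of _ "\<gamma>s @ \<delta>s"]) auto
qed

lemma derives_nec: "\<Gamma> \<turnstile>\<^sub>M\<^sub>S \<phi> \<Longrightarrow> \<Gamma> \<turnstile>\<^sub>M\<^sub>S All \<phi>"
  unfolding derives_def by (meson global_lift global_simp)

lemma normal_theory_derives: "normal_theory (derives \<Gamma>)"
  by unfold_locales (fact derives_ax derives_mp derives_nec)+

text \<open>Deduction theorem for global consequence. All occurrences of \<delta> are removed from
  the list of premises and gathered in one conjunct, which (A3) splits off under
  \<open>All\<close>.\<close>

lemma derives_insert:
  assumes "insert \<delta> \<Gamma> \<turnstile>\<^sub>M\<^sub>S \<phi>"
  shows "\<Gamma> \<turnstile>\<^sub>M\<^sub>S All \<delta> \<^bold>\<rightarrow> \<phi>"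
proof -
  obtain \<gamma>s where s: "set \<gamma>s \<subseteq> insert \<delta> \<Gamma>" and d: "ms2icu (All (conjs \<gamma>s) \<^bold>\<rightarrow> \<phi>)"
    using assms unfolding derives_def by blast
  let ?d = "removeAll \<delta> \<gamma>s"
  have "ms2icu (All (\<delta> \<^bold>\<and> conjs ?d) \<^bold>\<rightarrow> All (conjs \<gamma>s))"
    by (rule ms2icu_all_mono, rule ms2icu_taut) (auto simp: bval_conjs)
  then have "ms2icu (All (conjs ?d) \<^bold>\<rightarrow> (All \<delta> \<^bold>\<rightarrow> \<phi>))"
    by (rule ms.prop3[OF d _ ms2icu_all_conj[of \<delta> "conjs ?d"]]) auto
  then show ?thesis
    using s unfolding derives_def by (intro exI[of _ ?d]) auto
qed

lemma derives_insert_global: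
  assumes "insert \<delta> \<Gamma> \<turnstile>\<^sub>M\<^sub>S \<phi>" "global \<delta>"
  shows "\<Gamma> \<turnstile>\<^sub>M\<^sub>S \<delta> \<^bold>\<rightarrow> \<phi>"
proof -
  interpret normal_theory "derives \<Gamma>"
    by (rule normal_theory_derives)
  show ?thesis
    by (rule prop2[OF derives_insert[OF assms(1)] ax[OF assms(2)[unfolded global_def]]]) auto
qed

section \<open>Renaming of variables\<close>

lemma map_form_fun_upd: "p \<notin> vars \<phi> \<Longrightarrow> map_form (f(p := q)) \<phi> = map_form f \<phi>"
  by (auto intro: form.map_cong)

text \<open>The renaming may be non-injective and identify the fresh variable of a rule with another
  one. In those cases the induction hypothesis is used for \<open>f(p := q)\<close> with a new
  \<open>q\<close>, which agrees with \<open>f\<close> on the remaining formulas.\<close>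

lemma ms2icu_rename: "ms2icu \<phi> \<Longrightarrow> ms2icu (map_form f \<phi>)"
proof (induct arbitrary: f rule: ms2icu.induct)
  case (Taut \<alpha> \<sigma>)
  have "map_form f (inst \<sigma> \<alpha>) = inst (map_form f \<circ> \<sigma>) \<alpha>"
    by (induct \<alpha>) auto
  then show ?case
    using Taut ms2icu.Taut by simp
next
  case (MP \<phi> \<psi>)
  then show ?case by (metis form.map(7) ms2icu.MP)
next
  case (Interpolate \<phi> p \<psi> \<chi>)
  obtain q where q: "q \<notin> vars (map_form f \<phi>) \<union> vars (map_form f \<psi>) \<union> vars (map_form f \<chi>)"
    using ex_new_if_finite[OF infinite_UNIV_nat] by (metis finite_UnI finite_vars)
  then show ?case
    using Interpolate(2)[of "f(p := q)"] Interpolate(3) ms2icu.Interpolate[where p = q]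
    by (simp add: map_form_fun_upd del: fun_upd_apply) (simp add: fun_upd_same)
next
  case (Approximate p \<phi> \<chi>)
  obtain q where q: "q \<notin> vars (map_form f \<phi>) \<union> vars (map_form f \<chi>)"
    using ex_new_if_finite[OF infinite_UNIV_nat] by (metis finite_UnI finite_vars)
  then show ?case
    using Approximate(2)[of "f(p := q)"] Approximate(3) ms2icu.Approximate[where p = q]
    by (simp add: map_form_fun_upd del: fun_upd_apply) (simp add: fun_upd_same)
next
  case (Continuous p \<phi> \<chi>)
  obtain q where q: "q \<notin> vars (map_form f \<phi>) \<union> vars (map_form f \<chi>)"
    using ex_new_if_finite[OF infinite_UNIV_nat] by (metis finite_UnI finite_vars)
  then show ?case
    using Continuous(2)[of "f(p := q)"] Continuous(3) ms2icu.Continuous[where p = q]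
    by (simp add: map_form_fun_upd del: fun_upd_apply) (simp add: fun_upd_same)
next
  case (Repl \<phi> \<phi>' \<psi> \<psi>')
  then show ?case by (simp only: form.map ms2icu.Repl)
next
  case (NecAll \<phi>)
  then show ?case by (simp only: form.map ms2icu.NecAll)
next
  case (NecBox \<phi>)
  then show ?case by (simp only: form.map ms2icu.NecBox)
qed (simp_all only: form.map ms2icu.A1 ms2icu.A2 ms2icu.A3 ms2icu.A4 ms2icu.A5 ms2icu.A8 ms2icu.A9
    ms2icu.A10 ms2icu.A11 ms2icu.K ms2icu.Add)

lemma map_form_conjs: "map_form f (conjs \<gamma>s) = conjs (map (map_form f) \<gamma>s)"
  by (induct \<gamma>s rule: conjs.induct) auto

text \<open>The given derivation is itself renamed by the left inverse, which sends its premises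
  back into \<Gamma>.\<close>

lemma derives_unrename:
  assumes "g \<circ> f = id" "map_form f ` \<Gamma> \<turnstile>\<^sub>M\<^sub>S map_form f \<phi>"
  shows "\<Gamma> \<turnstile>\<^sub>M\<^sub>S \<phi>"
proof -
  have inv: "map_form g (map_form f \<psi>) = \<psi>" for \<psi>
    using assms(1) by (simp add: form.map_comp form.map_id)
  obtain \<gamma>s where s: "set \<gamma>s \<subseteq> map_form f ` \<Gamma>" and d: "ms2icu (All (conjs \<gamma>s) \<^bold>\<rightarrow> map_form f \<phi>)"
    using assms unfolding derives_def by blast
  have "ms2icu (All (conjs (map (map_form g) \<gamma>s)) \<^bold>\<rightarrow> \<phi>)"
    using ms2icu_rename[OF d, of g] by (simp add: inv map_form_conjs)
  moreover have "set (map (map_form g) \<gamma>s) \<subseteq> \<Gamma>"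
    using s by (auto simp: inv)
  ultimately show ?thesis
    unfolding derives_def by blast
qed

section \<open>Henkin extensions\<close>

text \<open>
  The indices 0, 1 and 2 stand for the rules \<open>Interpolate\<close>, \<open>Approximate\<close> and \<open>Continuous\<close>, the
  last two in the contrapositive form in which the demand is a failing inclusion. Every other index
  demands an arbitrary formula without a witness, which makes the extension maximal.
\<close>

definition demand :: "nat \<Rightarrow> fm \<Rightarrow> fm \<Rightarrow> fm" where
  "demand k \<alpha> \<chi> =
    (if k = 0 then \<alpha> \<leadsto> \<chi> else if k = 1 then Neg (All (\<alpha> \<^bold>\<rightarrow> \<chi>))
     else if k = 2 then Neg (All (Box \<alpha> \<^bold>\<rightarrow> \<chi>)) else \<alpha>)"

text \<open>For indices 1 and 2 the failing inclusion is repeated with the variable in place of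
  \<alpha>: something strictly inside \<alpha> already violates it. Negated \<open>All\<close>
  formulas are used so that the witness is \<open>global\<close>.\<close>

definition witness :: "nat \<Rightarrow> fm \<Rightarrow> fm \<Rightarrow> nat \<Rightarrow> fm" where
  "witness k \<alpha> \<chi> p =
    (if k = 0 then (\<alpha> \<leadsto> Var p) \<^bold>\<and> (Var p \<leadsto> \<chi>)
     else if k = 1 then (Var p \<leadsto> \<alpha>) \<^bold>\<and> Neg (All (Var p \<^bold>\<rightarrow> \<chi>))
     else if k = 2 then (Var p \<leadsto> \<alpha>) \<^bold>\<and> Neg (All (Box (Var p) \<^bold>\<rightarrow> \<chi>)) else Top)"

lemma global_witness: "global (witness k \<alpha> \<chi> p)"
proof -
  have "global Top"
    unfolding global_def
    by (rule ms.prop1[OF ms2icu.NecAll[OF ms2icu_taut[of Top]]]) simp_all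
  then show ?thesis
    by (simp add: witness_def global_conj global_simp global_neg_simp)
qed

lemma vars_conjs: "vars (conjs \<gamma>s) \<subseteq> \<Union>(vars ` set \<gamma>s)"
  by (induct \<gamma>s rule: conjs.induct) auto

text \<open>Common core of \<open>Approximate\<close> (\<beta> is the variable, \<theta> is
  \<alpha>) and \<open>Continuous\<close> (both under \<open>Box\<close>). The premises from
  \<Gamma> and \<open>Neg (All \<phi>)\<close> are packed into the side formula \<psi> of the
  rule.\<close>

lemma derives_approximation_rule:
  assumes rule: "\<And>\<psi>. \<lbrakk>ms2icu ((Var p \<leadsto> \<alpha>) \<^bold>\<and> \<beta> \<^bold>\<rightarrow> \<psi>); p \<notin> vars \<psi>\<rbrakk> \<Longrightarrow> ms2icu (\<theta> \<^bold>\<rightarrow> \<psi>)"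
    and fresh: "p \<notin> \<Union>(vars ` \<Gamma>) \<union> vars \<chi> \<union> vars \<phi>"
    and d: "\<Gamma> \<turnstile>\<^sub>M\<^sub>S ((Var p \<leadsto> \<alpha>) \<^bold>\<and> Neg (All (\<beta> \<^bold>\<rightarrow> \<chi>))) \<^bold>\<rightarrow> All \<phi>"
    and \<theta>: "\<Gamma> \<turnstile>\<^sub>M\<^sub>S Neg (All (\<theta> \<^bold>\<rightarrow> \<chi>))"
  shows "\<Gamma> \<turnstile>\<^sub>M\<^sub>S All \<phi>"
proof -
  obtain \<gamma>s where s: "set \<gamma>s \<subseteq> \<Gamma>"
    and m: "ms2icu (All (conjs \<gamma>s) \<^bold>\<rightarrow> (((Var p \<leadsto> \<alpha>) \<^bold>\<and> Neg (All (\<beta> \<^bold>\<rightarrow> \<chi>))) \<^bold>\<rightarrow> All \<phi>))"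
    using d unfolding derives_def by blast
  let ?c = "All (conjs \<gamma>s)"
  \<comment> \<open>If \<open>All \<phi>\<close> fails, the premise yields the \<open>All\<close>
    closure of the inclusion of \<beta> in \<chi>; (A4) releases the inclusion, and \<beta> gives
    \<chi>.\<close>
  have "ms2icu ((Var p \<leadsto> \<alpha>) \<^bold>\<and> \<beta> \<^bold>\<rightarrow> (?c \<^bold>\<and> Neg (All \<phi>) \<^bold>\<rightarrow> \<chi>))"
    by (rule ms.prop2[OF m ms2icu.A4[of Top "\<beta> \<^bold>\<rightarrow> \<chi>"]]) auto
  moreover have "p \<notin> vars (?c \<^bold>\<and> Neg (All \<phi>) \<^bold>\<rightarrow> \<chi>)"
    using fresh s vars_conjs[of \<gamma>s] by auto
  ultimately have "ms2icu (\<theta> \<^bold>\<rightarrow> (?c \<^bold>\<and> Neg (All \<phi>) \<^bold>\<rightarrow> \<chi>))"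
    by (rule rule)
  then have "ms2icu (?c \<^bold>\<and> Neg (All \<phi>) \<^bold>\<rightarrow> (\<theta> \<^bold>\<rightarrow> \<chi>))"
    by (rule ms.prop1) auto
  \<comment> \<open>Both premises are global, so the conclusion may be necessitated while they stay
    unchanged.\<close>
  then have "ms2icu (?c \<^bold>\<and> Neg (All \<phi>) \<^bold>\<rightarrow> All (\<theta> \<^bold>\<rightarrow> \<chi>))"
    by (intro global_lift global_conj global_simp global_neg_simp)
  then have "ms2icu (?c \<^bold>\<rightarrow> (Neg (All (\<theta> \<^bold>\<rightarrow> \<chi>)) \<^bold>\<rightarrow> All \<phi>))"
    by (rule ms.prop1) auto
  then have "\<Gamma> \<turnstile>\<^sub>M\<^sub>S Neg (All (\<theta> \<^bold>\<rightarrow> \<chi>)) \<^bold>\<rightarrow> All \<phi>"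
    using s unfolding derives_def by blast
  then show ?thesis
    using \<theta> by (rule derives_mp)
qed

lemma derives_interpolation_rule:
  assumes fresh: "p \<notin> \<Union>(vars ` \<Gamma>) \<union> vars \<alpha> \<union> vars \<beta> \<union> vars \<phi>"
    and d: "\<Gamma> \<turnstile>\<^sub>M\<^sub>S ((\<alpha> \<leadsto> Var p) \<^bold>\<and> (Var p \<leadsto> \<beta>)) \<^bold>\<rightarrow> \<phi>"
    and \<theta>: "\<Gamma> \<turnstile>\<^sub>M\<^sub>S \<alpha> \<leadsto> \<beta>"
  shows "\<Gamma> \<turnstile>\<^sub>M\<^sub>S \<phi>"
proof -
  obtain \<gamma>s where s: "set \<gamma>s \<subseteq> \<Gamma>"
    and m: "ms2icu (All (conjs \<gamma>s) \<^bold>\<rightarrow> (((\<alpha> \<leadsto> Var p) \<^bold>\<and> (Var p \<leadsto> \<beta>)) \<^bold>\<rightarrow> \<phi>))"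
    using d unfolding derives_def by blast
  let ?c = "All (conjs \<gamma>s)"
  have "ms2icu ((\<alpha> \<leadsto> Var p) \<^bold>\<and> (Var p \<leadsto> \<beta>) \<^bold>\<rightarrow> (?c \<^bold>\<rightarrow> \<phi>))"
    by (rule ms.prop1[OF m]) auto
  moreover have "p \<notin> vars \<alpha> \<union> vars \<beta> \<union> vars (?c \<^bold>\<rightarrow> \<phi>)"
    using fresh s vars_conjs[of \<gamma>s] by auto
  ultimately have "ms2icu ((\<alpha> \<leadsto> \<beta>) \<^bold>\<rightarrow> (?c \<^bold>\<rightarrow> \<phi>))"
    by (rule ms2icu.Interpolate)
  then have "ms2icu (?c \<^bold>\<rightarrow> ((\<alpha> \<leadsto> \<beta>) \<^bold>\<rightarrow> \<phi>))"
    by (rule ms.prop1) auto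
  then have "\<Gamma> \<turnstile>\<^sub>M\<^sub>S (\<alpha> \<leadsto> \<beta>) \<^bold>\<rightarrow> \<phi>"
    using s unfolding derives_def by blast
  then show ?thesis
    using \<theta> by (rule derives_mp)
qed

text \<open>A witness leading to \<open>All \<phi>\<close> could be discharged, being global. The
  rule belonging to the index would then eliminate the fresh variable, and the demand alone would
  already lead to \<open>All \<phi>\<close>.\<close>

lemma witness_consistent:
  assumes con: "\<not> insert (demand k \<alpha> \<chi>) \<Gamma> \<turnstile>\<^sub>M\<^sub>S All \<phi>"
    and fresh: "p \<notin> \<Union>(vars ` insert (demand k \<alpha> \<chi>) \<Gamma>) \<union> vars \<alpha> \<union> vars \<chi> \<union> vars \<phi>"
  shows "\<not> insert (witness k \<alpha> \<chi> p) (insert (demand k \<alpha> \<chi>) \<Gamma>) \<turnstile>\<^sub>M\<^sub>S All \<phi>"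
proof
  let ?G = "insert (demand k \<alpha> \<chi>) \<Gamma>"
  interpret normal_theory "derives ?G"
    by (rule normal_theory_derives)
  assume "insert (witness k \<alpha> \<chi> p) ?G \<turnstile>\<^sub>M\<^sub>S All \<phi>"
  then have d: "?G \<turnstile>\<^sub>M\<^sub>S witness k \<alpha> \<chi> p \<^bold>\<rightarrow> All \<phi>"
    using global_witness by (rule derives_insert_global)
  have dem: "?G \<turnstile>\<^sub>M\<^sub>S demand k \<alpha> \<chi>"
    by (simp add: derives_in)
  consider "k = 0" | "k = 1" | "k = 2" | "k > 2"
    by linarith
  then have "?G \<turnstile>\<^sub>M\<^sub>S All \<phi>"
  proof cases
    case 1
    then show ?thesis
      using fresh d dem
      by (intro derives_interpolation_rule[of p ?G \<alpha> \<chi> "All \<phi>"]) (auto simp: demand_def witness_def)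
  next
    case 2
    show ?thesis
    proof (rule derives_approximation_rule[of p \<alpha> "Var p" \<alpha> ?G \<chi>])
      fix \<psi> assume prem: "ms2icu ((Var p \<leadsto> \<alpha>) \<^bold>\<and> Var p \<^bold>\<rightarrow> \<psi>)" and "p \<notin> vars \<psi>"
      then have "p \<notin> vars \<alpha> \<union> vars \<psi>"
        using fresh by simp
      with prem show "ms2icu (\<alpha> \<^bold>\<rightarrow> \<psi>)"
        by (rule ms2icu.Approximate)
    qed (use 2 fresh d dem in \<open>simp_all add: demand_def witness_def\<close>)
  next
    case 3
    show ?thesis
    proof (rule derives_approximation_rule[of p \<alpha> "Box (Var p)" "Box \<alpha>" ?G \<chi>])
      fix \<psi> assume prem: "ms2icu ((Var p \<leadsto> \<alpha>) \<^bold>\<and> Box (Var p) \<^bold>\<rightarrow> \<psi>)" and "p \<notin> vars \<psi>"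
      then have "p \<notin> vars \<alpha> \<union> vars \<psi>"
        using fresh by simp
      with prem show "ms2icu (Box \<alpha> \<^bold>\<rightarrow> \<psi>)"
        by (rule ms2icu.Continuous)
    qed (use 3 fresh d dem in \<open>simp_all add: demand_def witness_def\<close>)
  next
    case 4
    then have "?G \<turnstile>\<^sub>M\<^sub>S Top \<^bold>\<rightarrow> All \<phi>"
      using d by (simp add: witness_def)
    then show ?thesis
      by (rule prop1) simp
  qed
  then show False
    using con by blast
qed

section \<open>Compactness and the construction of saturated theories\<close>

lemma derives_Union_chain:
  assumes "\<And>n :: nat. S n \<subseteq> S (Suc n)" "\<Union>(range S) \<turnstile>\<^sub>M\<^sub>S \<phi>"
  shows "\<exists>n. S n \<turnstile>\<^sub>M\<^sub>S \<phi>"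
proof -
  obtain \<gamma>s where s: "set \<gamma>s \<subseteq> \<Union>(range S)" and m: "ms2icu (All (conjs \<gamma>s) \<^bold>\<rightarrow> \<phi>)"
    using assms(2) unfolding derives_def by blast
  have mono: "S m \<subseteq> S n" if "m \<le> n" for m n
    using lift_Suc_mono_le[of S m n] assms(1) that by blast
  have "\<exists>n. F \<subseteq> S n" if "finite F" "F \<subseteq> \<Union>(range S)" for F
    using that
  proof (induct rule: finite_induct)
    case (insert x F)
    then obtain m n where "F \<subseteq> S m" "x \<in> S n"
      by blast
    then have "insert x F \<subseteq> S (max m n)"
      using mono[of m "max m n"] mono[of n "max m n"] by auto
    then show ?case ..
  qed simp
  then obtain n where "set \<gamma>s \<subseteq> S n"
    using s by blast
  then show ?thesis
    using m unfolding derives_def by blast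
qed

text \<open>Read in the Lindenbaum algebra, the clauses give two-valued strict implication,
  interpolation, nonzero approximants and upper continuity. The last is stated dually:
  \<open>Box a\<close> is the join of all \<open>Box c\<close> with
  \<open>c \<leadsto> a\<close>.\<close>

locale saturated_theory = normal_theory +
  assumes neg_complete: "P (a \<leadsto> b) \<or> P (Neg (a \<leadsto> b))"
    and interpolant: "P (a \<leadsto> b) \<Longrightarrow> \<exists>c. P (a \<leadsto> c) \<and> P (c \<leadsto> b)"
    and approximant: "\<not> P (a \<^bold>\<rightarrow> b) \<Longrightarrow> \<exists>c. P (c \<leadsto> a) \<and> \<not> P (c \<^bold>\<rightarrow> b)"
    and box_approximant: "\<not> P (Box a \<^bold>\<rightarrow> b) \<Longrightarrow> \<exists>c. P (c \<leadsto> a) \<and> \<not> P (Box c \<^bold>\<rightarrow> b)"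

text \<open>Stage n treats the triple coded by n. A demand consistent with the union is consistent
  with the smaller theory at its own stage, so visiting each triple once suffices.\<close>

lemma henkin_chain:
  assumes con: "\<not> \<Gamma> \<turnstile>\<^sub>M\<^sub>S All \<phi>" and inf: "infinite (- \<Union>(vars ` \<Gamma>))"
  shows "\<exists>T. \<Gamma> \<subseteq> T \<and> \<not> T \<turnstile>\<^sub>M\<^sub>S All \<phi> \<and>
    (\<forall>k \<alpha> \<chi>. \<not> insert (demand k \<alpha> \<chi>) T \<turnstile>\<^sub>M\<^sub>S All \<phi> \<longrightarrow>
      demand k \<alpha> \<chi> \<in> T \<and> (\<exists>p. witness k \<alpha> \<chi> p \<in> T))"
proof -
  let ?I = "\<lambda>S. \<not> S \<turnstile>\<^sub>M\<^sub>S All \<phi> \<and> infinite (- \<Union>(vars ` S))"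
  let ?Q = "\<lambda>n S S'. S \<subseteq> S' \<and> (\<forall>k \<alpha> \<chi>. from_nat n = (k, \<alpha>, \<chi>) \<longrightarrow>
    \<not> insert (demand k \<alpha> \<chi>) S \<turnstile>\<^sub>M\<^sub>S All \<phi> \<longrightarrow> demand k \<alpha> \<chi> \<in> S' \<and> (\<exists>p. witness k \<alpha> \<chi> p \<in> S'))"
  have step: "\<exists>S'. ?I S' \<and> ?Q n S S'" if I: "?I S" for S n
  proof -
    obtain k \<alpha> \<chi> where n: "from_nat n = (k :: nat, \<alpha> :: fm, \<chi> :: fm)"
      by (cases "from_nat n :: nat \<times> fm \<times> fm") auto
    let ?d = "demand k \<alpha> \<chi>"
    show ?thesis
    proof (cases "insert ?d S \<turnstile>\<^sub>M\<^sub>S All \<phi>")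
      case True
      then show ?thesis
        using I n by (intro exI[of _ S]) auto
    next
      case False
      have "infinite (- \<Union>(vars ` S) - (vars ?d \<union> vars \<alpha> \<union> vars \<chi> \<union> vars \<phi>))"
        using I by (intro Diff_infinite_finite) (auto simp: finite_vars)
      then obtain p where p: "p \<in> - \<Union>(vars ` S) - (vars ?d \<union> vars \<alpha> \<union> vars \<chi> \<union> vars \<phi>)"
        using infinite_imp_nonempty by blast
      let ?w = "witness k \<alpha> \<chi> p"
      let ?S = "insert ?w (insert ?d S)"
      have "\<not> ?S \<turnstile>\<^sub>M\<^sub>S All \<phi>"
        using False p by (intro witness_consistent) auto
      moreover have "- \<Union>(vars ` ?S) = - \<Union>(vars ` S) - (vars ?w \<union> vars ?d)"
        by auto
      then have "infinite (- \<Union>(vars ` ?S))"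
        using I by (simp only:) (intro Diff_infinite_finite, auto simp: finite_vars)
      ultimately show ?thesis
        using n by (intro exI[of _ ?S]) auto
    qed
  qed
  \<comment> \<open>Dependent choice does not prescribe the first element, so the starting point
    \<Gamma> is built into the predicate at n = 0.\<close>
  have "\<exists>S. \<forall>n. (?I (S n) \<and> (n = 0 \<longrightarrow> S n = \<Gamma>)) \<and> ?Q n (S n) (S (Suc n))"
  proof (rule dependent_nat_choice)
    show "\<exists>S. ?I S \<and> (0 = (0 :: nat) \<longrightarrow> S = \<Gamma>)"
      using con inf by blast
  next
    fix S and n :: nat
    assume "?I S \<and> (n = 0 \<longrightarrow> S = \<Gamma>)"
    then show "\<exists>S'. (?I S' \<and> (Suc n = 0 \<longrightarrow> S' = \<Gamma>)) \<and> ?Q n S S'"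
      using step[of S n] by (metis nat.distinct(1))
  qed
  then obtain S where S: "\<And>n. ?I (S n)" "\<And>n. ?Q n (S n) (S (Suc n))" and S0: "S 0 = \<Gamma>"
    by metis
  let ?T = "\<Union>(range S)"
  have "\<Gamma> \<subseteq> ?T"
    using S0 by blast
  moreover have "\<not> ?T \<turnstile>\<^sub>M\<^sub>S All \<phi>"
    using derives_Union_chain[of S "All \<phi>"] S by blast
  moreover have "demand k \<alpha> \<chi> \<in> ?T \<and> (\<exists>p. witness k \<alpha> \<chi> p \<in> ?T)"
    if nd: "\<not> insert (demand k \<alpha> \<chi>) ?T \<turnstile>\<^sub>M\<^sub>S All \<phi>" for k \<alpha> \<chi>
  proof -
    let ?n = "to_nat (k, \<alpha>, \<chi>)"
    have "\<not> insert (demand k \<alpha> \<chi>) (S ?n) \<turnstile>\<^sub>M\<^sub>S All \<phi>"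
      using nd derives_mono[of "insert (demand k \<alpha> \<chi>) (S ?n)" "All \<phi>" "insert (demand k \<alpha> \<chi>) ?T"] by blast
    moreover have "from_nat ?n = (k, \<alpha>, \<chi>)"
      by simp
    ultimately show ?thesis
      using S(2)[of ?n] by blast
  qed
  ultimately show ?thesis
    by blast
qed

theorem saturated_extension:
  assumes "\<not> \<Gamma> \<turnstile>\<^sub>M\<^sub>S All \<phi>" "infinite (- \<Union>(vars ` \<Gamma>))"
  shows "\<exists>P. saturated_theory P \<and> (\<forall>\<gamma>\<in>\<Gamma>. P \<gamma>) \<and> \<not> P \<phi>"
proof -
  obtain T where T: "\<Gamma> \<subseteq> T" "\<not> T \<turnstile>\<^sub>M\<^sub>S All \<phi>"
    and wit: "\<And>k \<alpha> \<chi>. \<not> insert (demand k \<alpha> \<chi>) T \<turnstile>\<^sub>M\<^sub>S All \<phi> \<Longrightarrow>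
      demand k \<alpha> \<chi> \<in> T \<and> (\<exists>p. witness k \<alpha> \<chi> p \<in> T)"
    using henkin_chain[OF assms] by blast
  interpret normal_theory "derives T"
    by (rule normal_theory_derives)
  \<comment> \<open>A derivable demand cannot lead to \<open>All \<phi>\<close> without T doing so
    itself; hence it is consistent with T and was given a witness.\<close>
  have wit': "\<exists>p. T \<turnstile>\<^sub>M\<^sub>S witness k \<alpha> \<chi> p" if "T \<turnstile>\<^sub>M\<^sub>S demand k \<alpha> \<chi>" for k \<alpha> \<chi>
  proof -
    have "\<not> insert (demand k \<alpha> \<chi>) T \<turnstile>\<^sub>M\<^sub>S All \<phi>"
      using T(2) derives_insert[of "demand k \<alpha> \<chi>" T "All \<phi>"] nec[OF that] mp by blast
    then show ?thesis
      using wit derives_in by blast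
  qed
  have con: "\<not> T \<turnstile>\<^sub>M\<^sub>S Bot"
  proof
    assume "T \<turnstile>\<^sub>M\<^sub>S Bot"
    then have "T \<turnstile>\<^sub>M\<^sub>S All \<phi>"
      by (rule prop1) simp
    then show False
      using T(2) by blast
  qed
  have compl: "T \<turnstile>\<^sub>M\<^sub>S a \<leadsto> b \<or> T \<turnstile>\<^sub>M\<^sub>S Neg (a \<leadsto> b)" for a b
  proof (rule ccontr)
    assume n: "\<not> (T \<turnstile>\<^sub>M\<^sub>S a \<leadsto> b \<or> T \<turnstile>\<^sub>M\<^sub>S Neg (a \<leadsto> b))"
    \<comment> \<open>Index 3 demands \<delta> itself, so maximality says that every underivable
      formula is inconsistent with T. Applied to a strict implication and to its negation, this
      would make T derive \<open>All \<phi>\<close>.\<close>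
    have "insert \<delta> T \<turnstile>\<^sub>M\<^sub>S All \<phi>" if "\<not> T \<turnstile>\<^sub>M\<^sub>S \<delta>" for \<delta>
      using wit[of 3 \<delta>] that derives_in[of \<delta> T] by (auto simp: demand_def)
    then have "T \<turnstile>\<^sub>M\<^sub>S (a \<leadsto> b) \<^bold>\<rightarrow> All \<phi>" "T \<turnstile>\<^sub>M\<^sub>S Neg (a \<leadsto> b) \<^bold>\<rightarrow> All \<phi>"
      using n by (blast intro: derives_insert_global global_simp global_neg_simp)+
    then have "T \<turnstile>\<^sub>M\<^sub>S All \<phi>"
      by (rule prop2) auto
    then show False
      using T(2) by blast
  qed
  \<comment> \<open>Translates the negated \<open>All\<close> formulas of demands and witnesses into
    the underivability statements of \<open>saturated_theory\<close>.\<close>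
  have neg_all: "T \<turnstile>\<^sub>M\<^sub>S Neg (All a) \<longleftrightarrow> \<not> T \<turnstile>\<^sub>M\<^sub>S a" for a
  proof
    assume na: "T \<turnstile>\<^sub>M\<^sub>S Neg (All a)"
    show "\<not> T \<turnstile>\<^sub>M\<^sub>S a"
    proof
      assume "T \<turnstile>\<^sub>M\<^sub>S a"
      from prop2[OF nec[OF this] na, of Bot] show False
        using con by simp
    qed
  next
    assume "\<not> T \<turnstile>\<^sub>M\<^sub>S a"
    then show "T \<turnstile>\<^sub>M\<^sub>S Neg (All a)"
      using compl[of Top a] all_elim by blast
  qed
  have conj: "T \<turnstile>\<^sub>M\<^sub>S a \<and> T \<turnstile>\<^sub>M\<^sub>S b" if "T \<turnstile>\<^sub>M\<^sub>S a \<^bold>\<and> b" for a b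
    using prop1[OF that, of a] prop1[OF that, of b] by simp
  have "saturated_theory (derives T)"
  proof
    fix a b
    show "T \<turnstile>\<^sub>M\<^sub>S a \<leadsto> b \<or> T \<turnstile>\<^sub>M\<^sub>S Neg (a \<leadsto> b)"
      by (fact compl)
    show "\<exists>c. T \<turnstile>\<^sub>M\<^sub>S a \<leadsto> c \<and> T \<turnstile>\<^sub>M\<^sub>S c \<leadsto> b" if "T \<turnstile>\<^sub>M\<^sub>S a \<leadsto> b"
      using wit'[of 0 a b] that by (auto simp: demand_def witness_def dest!: conj)
    show "\<exists>c. T \<turnstile>\<^sub>M\<^sub>S c \<leadsto> a \<and> \<not> T \<turnstile>\<^sub>M\<^sub>S c \<^bold>\<rightarrow> b" if "\<not> T \<turnstile>\<^sub>M\<^sub>S a \<^bold>\<rightarrow> b"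
      using wit'[of 1 a b] that by (auto simp: demand_def witness_def neg_all dest!: conj)
    show "\<exists>c. T \<turnstile>\<^sub>M\<^sub>S c \<leadsto> a \<and> \<not> T \<turnstile>\<^sub>M\<^sub>S Box c \<^bold>\<rightarrow> b" if "\<not> T \<turnstile>\<^sub>M\<^sub>S Box a \<^bold>\<rightarrow> b"
      using wit'[of 2 a b] that by (auto simp: demand_def witness_def neg_all dest!: conj)
  qed
  moreover have "\<not> T \<turnstile>\<^sub>M\<^sub>S \<phi>"
    using T(2) nec by blast
  ultimately show ?thesis
    using T(1) derives_in by blast
qed

section \<open>Ultrafilters of a Boolean lattice\<close>

context boolean_lattice
begin

lemma meet_top: "x \<in> carrier L \<Longrightarrow> x \<sqinter> \<top> = x"
  using top_meet[of x] by (simp add: eq_is_equal meet_comm)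

lemma bottom_join_eq: "x \<in> carrier L \<Longrightarrow> \<bottom> \<squnion> x = x"
  using bottom_join[of x] by (simp add: eq_is_equal)

lemma complement_props:
  assumes x: "x \<in> carrier L"
  shows complement_closed: "\<sim> x \<in> carrier L"
    and meet_complement: "x \<sqinter> \<sim> x = \<bottom>"
    and join_complement: "x \<squnion> \<sim> x = \<top>"
proof -
  \<comment> \<open>Any element disjoint from x lies below any element that covers the rest of the
    algebra together with x. Used in both directions, this makes complements unique, so the
    description in \<open>complement\<close> is proper.\<close>
  have le: "y \<sqsubseteq> z" if "y \<in> carrier L" "z \<in> carrier L" "x \<sqinter> y = \<bottom>" "x \<squnion> z = \<top>" for y z
  proof -
    have "y = y \<sqinter> (x \<squnion> z)"
      using that by (simp add: meet_top)
    also have "\<dots> = (y \<sqinter> x) \<squnion> (y \<sqinter> z)"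
      using that x by (intro meet_join_distrib)
    also have "\<dots> = y \<sqinter> z"
      using that by (simp add: bottom_join_eq meet_comm[of _ y x])
    finally show ?thesis
      using that meet_right[of y z] by simp
  qed
  have "\<exists>!y. y \<in> carrier L \<and> x \<sqinter> y = \<bottom> \<and> x \<squnion> y = \<top>"
    using complement_exists[OF x] le by (blast intro: le_antisym)
  from theI'[OF this]
  show "\<sim> x \<in> carrier L" "x \<sqinter> \<sim> x = \<bottom>" "x \<squnion> \<sim> x = \<top>"
    unfolding complement_def by auto
qed

lemma le_complement:
  assumes "x \<in> carrier L" "u \<in> carrier L" "u \<sqinter> x = \<bottom>"
  shows "u \<sqsubseteq> \<sim> x"
proof -
  note c = complement_props[OF assms(1)]
  have "u = u \<sqinter> (x \<squnion> \<sim> x)"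
    using assms c by (simp add: meet_top)
  also have "\<dots> = \<bottom> \<squnion> (u \<sqinter> \<sim> x)"
    using assms c meet_join_distrib[of u x "\<sim> x"] by simp
  also have "\<dots> = u \<sqinter> \<sim> x"
    using assms c by (simp add: bottom_join_eq)
  finally show ?thesis
    using assms c meet_right[of u "\<sim> x"] by simp
qed

definition pfilter :: "'a set \<Rightarrow> bool" where
  "pfilter F \<longleftrightarrow> F \<subseteq> carrier L \<and> F \<noteq> {} \<and> \<bottom> \<notin> F \<and> (\<forall>x\<in>F. \<forall>y\<in>F. x \<sqinter> y \<in> F) \<and>
    (\<forall>x\<in>F. \<forall>y\<in>carrier L. x \<sqsubseteq> y \<longrightarrow> y \<in> F)"

definition ultrafilter :: "'a set \<Rightarrow> bool" where
  "ultrafilter U \<longleftrightarrow> pfilter U \<and> (\<forall>x\<in>carrier L. x \<in> U \<or> \<sim> x \<in> U)"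

lemma pfilter_Union_chain:
  assumes "C \<noteq> {}" "subset.chain (Collect pfilter) C"
  shows "pfilter (\<Union>C)"
proof -
  have p: "\<And>F. F \<in> C \<Longrightarrow> pfilter F" and c: "\<And>F G. \<lbrakk>F \<in> C; G \<in> C\<rbrakk> \<Longrightarrow> F \<subseteq> G \<or> G \<subseteq> F"
    using assms(2) by (auto simp: subset_chain_def)
  have "x \<sqinter> y \<in> \<Union>C" if "x \<in> F" "F \<in> C" "y \<in> G" "G \<in> C" for x y F G
  proof -
    obtain H where "H \<in> C" "x \<in> H" "y \<in> H"
      using c[of F G] \<open>x \<in> F\<close> \<open>F \<in> C\<close> \<open>y \<in> G\<close> \<open>G \<in> C\<close> by blast
    then show ?thesis
      using p unfolding pfilter_def by blast
  qed
  moreover have "F \<subseteq> carrier L" "F \<noteq> {}" "\<bottom> \<notin> F" if "F \<in> C" for F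
    using p[OF that] unfolding pfilter_def by blast+
  then have "\<Union>C \<subseteq> carrier L" "\<Union>C \<noteq> {}" "\<bottom> \<notin> \<Union>C"
    using assms(1) by blast+
  moreover have "y \<in> \<Union>C" if "x \<in> \<Union>C" "y \<in> carrier L" "x \<sqsubseteq> y" for x y
    using that p unfolding pfilter_def by blast
  ultimately show ?thesis
    unfolding pfilter_def by blast
qed

text \<open>\<open>G\<close> is the filter generated by \<open>F\<close> and \<open>x\<close>; it is
  proper because no member of \<open>F\<close> is disjoint from \<open>x\<close>.\<close>

lemma pfilter_extend:
  assumes F: "pfilter F" and x: "x \<in> carrier L" and ne: "\<And>u. u \<in> F \<Longrightarrow> u \<sqinter> x \<noteq> \<bottom>"
  defines "G \<equiv> {y \<in> carrier L. \<exists>u\<in>F. u \<sqinter> x \<sqsubseteq> y}"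
  shows "pfilter G" "F \<subseteq> G" "x \<in> G"
proof -
  have Fc: "\<And>u. u \<in> F \<Longrightarrow> u \<in> carrier L"
    using F unfolding pfilter_def by blast
  show sub: "F \<subseteq> G"
    using Fc x meet_left[of _ x] unfolding G_def by blast
  show xG: "x \<in> G"
  proof -
    obtain u where "u \<in> F"
      using F unfolding pfilter_def by blast
    then show ?thesis
      using Fc x meet_right[of u x] unfolding G_def by blast
  qed
  have "y \<sqinter> z \<in> G" if y: "y \<in> G" and z: "z \<in> G" for y z
  proof -
    obtain u w where u: "u \<in> F" "u \<sqinter> x \<sqsubseteq> y" and w: "w \<in> F" "w \<sqinter> x \<sqsubseteq> z"
      and yz: "y \<in> carrier L" "z \<in> carrier L"
      using y z unfolding G_def by blast
    note c = Fc[OF u(1)] Fc[OF w(1)] x yz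
    let ?m = "(u \<sqinter> w) \<sqinter> x"
    have m: "?m \<in> carrier L" "?m \<sqsubseteq> u \<sqinter> w" "?m \<sqsubseteq> x"
      using c by (simp_all add: meet_left meet_right)
    have "?m \<sqsubseteq> u" "?m \<sqsubseteq> w"
      using c m le_trans[OF m(2) meet_left] le_trans[OF m(2) meet_right] by simp_all
    then have "?m \<sqsubseteq> u \<sqinter> x" "?m \<sqsubseteq> w \<sqinter> x"
      using c m by (simp_all add: meet_le)
    then have "?m \<sqsubseteq> y" "?m \<sqsubseteq> z"
      using c m le_trans[OF _ u(2)] le_trans[OF _ w(2)] by simp_all
    then have "?m \<sqsubseteq> y \<sqinter> z"
      using c m by (simp add: meet_le)
    moreover have "u \<sqinter> w \<in> F"
      using u w F unfolding pfilter_def by blast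
    ultimately show ?thesis
      using meet_closed[OF yz] unfolding G_def by blast
  qed
  moreover have "\<bottom> \<notin> G"
  proof
    assume "\<bottom> \<in> G"
    then obtain u where u: "u \<in> F" "u \<sqinter> x \<sqsubseteq> \<bottom>"
      unfolding G_def by blast
    then have "u \<sqinter> x = \<bottom>"
      using Fc x by (intro le_antisym) simp_all
    then show False
      using ne u by blast
  qed
  moreover have "z \<in> G" if yz: "y \<in> G" "z \<in> carrier L" "y \<sqsubseteq> z" for y z
  proof -
    obtain u where u: "u \<in> F" "u \<sqinter> x \<sqsubseteq> y" "y \<in> carrier L"
      using yz unfolding G_def by blast
    then have "u \<sqinter> x \<sqsubseteq> z"
      using Fc x yz le_trans[OF u(2) yz(3)] by simp
    then show ?thesis
      using yz u unfolding G_def by blast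
  qed
  moreover have "G \<subseteq> carrier L"
    unfolding G_def by blast
  ultimately show "pfilter G"
    using xG unfolding pfilter_def by blast
qed

lemma ex_ultrafilter:
  assumes x: "x \<in> carrier L" "x \<noteq> \<bottom>"
  shows "\<exists>U. ultrafilter U \<and> x \<in> U"
proof -
  let ?A = "{F. pfilter F \<and> x \<in> F}"
  have ne: "\<top> \<sqinter> x \<noteq> \<bottom>"
    using x meet_top[of x] by (simp add: meet_comm[of _ \<top> x])
  have "\<bottom> \<noteq> \<top>"
  proof
    assume "\<bottom> = \<top>"
    then have "x \<sqsubseteq> \<bottom>"
      using top_higher[OF x(1)] by simp
    then show False
      using x le_antisym[of x \<bottom>] by simp
  qed
  moreover have "y = \<top>" if "y \<in> carrier L" "\<top> \<sqsubseteq> y" for y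
    using that by (intro le_antisym) simp_all
  ultimately have "pfilter {\<top>}"
    unfolding pfilter_def by (simp add: meet_top)
  then have "\<exists>F. pfilter F \<and> x \<in> F"
    using pfilter_extend(1,3)[of "{\<top>}" x] x ne by blast
  then have "?A \<noteq> {}"
    by blast
  moreover have "\<Union>C \<in> ?A" if "C \<noteq> {}" "subset.chain ?A C" for C
  proof -
    have "subset.chain (Collect pfilter) C"
      using that(2) unfolding subset_chain_def by blast
    then have "pfilter (\<Union>C)"
      by (rule pfilter_Union_chain[OF that(1)])
    moreover have "x \<in> \<Union>C"
      using that unfolding subset_chain_def by blast
    ultimately show ?thesis
      by blast
  qed
  ultimately obtain U where U: "pfilter U" "x \<in> U"
    and max: "\<And>F. \<lbrakk>pfilter F; x \<in> F; U \<subseteq> F\<rbrakk> \<Longrightarrow> F = U"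
    using subset_Zorn_nonempty[of ?A] by auto
  have "y \<in> U \<or> \<sim> y \<in> U" if y: "y \<in> carrier L" for y
  proof (rule disjCI)
    assume ny: "\<sim> y \<notin> U"
    \<comment> \<open>A member of U disjoint from y would lie below the complement of y and force
      that complement into U. So U extends to a proper filter containing y, which equals U by
      maximality.\<close>
    have "u \<sqinter> y \<noteq> \<bottom>" if "u \<in> U" for u
      using that ny U y le_complement[OF y] complement_closed[OF y] unfolding pfilter_def by blast
    from pfilter_extend[OF U(1) y this] show "y \<in> U"
      using max U(2) by blast
  qed
  then show ?thesis
    using U unfolding ultrafilter_def by blast
qed

lemma ultrafilter_top: "ultrafilter U \<Longrightarrow> \<top> \<in> U"
  unfolding ultrafilter_def pfilter_def by (metis ex_in_conv subsetD top_closed top_higher)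

lemma ultrafilter_bottom: "ultrafilter U \<Longrightarrow> \<bottom> \<notin> U"
  unfolding ultrafilter_def pfilter_def by blast

lemma ultrafilter_mono: "\<lbrakk>ultrafilter U; x \<in> U; x \<sqsubseteq> y; y \<in> carrier L\<rbrakk> \<Longrightarrow> y \<in> U"
  unfolding ultrafilter_def pfilter_def by blast

lemma ultrafilter_meet:
  assumes "ultrafilter U" "x \<in> carrier L" "y \<in> carrier L"
  shows "x \<sqinter> y \<in> U \<longleftrightarrow> x \<in> U \<and> y \<in> U"
proof
  assume m: "x \<sqinter> y \<in> U"
  show "x \<in> U \<and> y \<in> U"
    using ultrafilter_mono[OF assms(1) m meet_left[OF assms(2,3)] assms(2)]
      ultrafilter_mono[OF assms(1) m meet_right[OF assms(2,3)] assms(3)] by blast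
next
  assume "x \<in> U \<and> y \<in> U"
  then show "x \<sqinter> y \<in> U"
    using assms(1) unfolding ultrafilter_def pfilter_def by blast
qed

lemma ultrafilter_complement:
  assumes "ultrafilter U" "x \<in> carrier L"
  shows "\<sim> x \<in> U \<longleftrightarrow> x \<notin> U"
proof -
  have "x \<in> U \<or> \<sim> x \<in> U"
    using assms unfolding ultrafilter_def by blast
  then show ?thesis
    using ultrafilter_meet[OF assms complement_closed[OF assms(2)]] ultrafilter_bottom[OF assms(1)]
    by (auto simp: meet_complement[OF assms(2)])
qed

lemma ultrafilter_join:
  assumes U: "ultrafilter U" and c: "x \<in> carrier L" "y \<in> carrier L"
  shows "x \<squnion> y \<in> U \<longleftrightarrow> x \<in> U \<or> y \<in> U"
proof
  assume *: "x \<squnion> y \<in> U"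
  show "x \<in> U \<or> y \<in> U"
  proof (rule ccontr)
    assume "\<not> (x \<in> U \<or> y \<in> U)"
    then have "\<sim> x \<sqinter> (x \<squnion> y) \<in> U" "y \<notin> U"
      using * U c by (auto simp: ultrafilter_meet ultrafilter_complement complement_closed)
    moreover have "\<sim> x \<sqinter> (x \<squnion> y) = \<bottom> \<squnion> (\<sim> x \<sqinter> y)"
      using c by (simp add: meet_join_distrib complement_closed meet_complement meet_comm[of _ "\<sim> x" x])
    moreover have "\<bottom> \<squnion> (\<sim> x \<sqinter> y) = \<sim> x \<sqinter> y"
      using c by (simp add: bottom_join_eq complement_closed)
    ultimately show False
      using U c by (simp add: ultrafilter_meet complement_closed)
  qed
next
  assume "x \<in> U \<or> y \<in> U"
  then show "x \<squnion> y \<in> U"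
    using ultrafilter_mono[OF U _ join_left[OF c]] ultrafilter_mono[OF U _ join_right[OF c]] c by auto
qed

lemmas ultrafilter_simps = ultrafilter_top ultrafilter_bottom ultrafilter_meet ultrafilter_join
  ultrafilter_complement complement_closed

text \<open>If the inequality fails, x meets the complement of y in a nonzero element, and an
  ultrafilter through that element separates x from y.\<close>

lemma le_ultrafilterI:
  assumes c: "x \<in> carrier L" "y \<in> carrier L" and *: "\<And>U. \<lbrakk>ultrafilter U; x \<in> U\<rbrakk> \<Longrightarrow> y \<in> U"
  shows "x \<sqsubseteq> y"
proof -
  have "x \<sqinter> \<sim> y = \<bottom>"
  proof (rule ccontr)
    assume "x \<sqinter> \<sim> y \<noteq> \<bottom>"
    then obtain W where W: "ultrafilter W" "x \<sqinter> \<sim> y \<in> W"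
      using ex_ultrafilter[of "x \<sqinter> \<sim> y"] c complement_closed by auto
    then have "x \<in> W" "y \<notin> W"
      using c by (simp_all add: ultrafilter_simps)
    then show False
      using * W by blast
  qed
  then have "x \<sqsubseteq> \<sim> (\<sim> y)"
    using c by (intro le_complement) (auto simp: ultrafilter_simps)
  \<comment> \<open>The double complement is cancelled by distributivity, since the general law
    below is itself derived from this lemma.\<close>
  moreover have "\<sim> (\<sim> y) = \<sim> (\<sim> y) \<sqinter> (y \<squnion> \<sim> y)"
    using c by (simp add: join_complement meet_top complement_closed)
  moreover have "\<dots> = \<bottom> \<squnion> (\<sim> (\<sim> y) \<sqinter> y)"
    using c by (simp add: meet_join_distrib complement_closed meet_comm[of _ "\<sim> (\<sim> y)" "\<sim> y"]
        meet_complement join_comm[of _ \<bottom>])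
  moreover have "\<dots> \<sqsubseteq> y"
    using c by (simp add: bottom_join_eq complement_closed meet_right)
  ultimately show ?thesis
    using c le_trans[of x "\<sim> (\<sim> y)" y] by (simp add: complement_closed)
qed

lemma eq_ultrafilterI:
  assumes "x \<in> carrier L" "y \<in> carrier L" "\<And>U. ultrafilter U \<Longrightarrow> x \<in> U \<longleftrightarrow> y \<in> U"
  shows "x = y"
  using assms by (intro le_antisym le_ultrafilterI) auto

lemma complement_complement: "x \<in> carrier L \<Longrightarrow> \<sim> (\<sim> x) = x"
  by (rule eq_ultrafilterI) (auto simp: ultrafilter_simps)

text \<open>Residuation: it moves one summand aside so that the other can be isolated on the right
  and approximated from above.\<close>

lemma le_join_iff_meet_complement:
  assumes "x \<in> carrier L" "y \<in> carrier L" "z \<in> carrier L"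
  shows "x \<sqsubseteq> y \<squnion> z \<longleftrightarrow> x \<sqinter> \<sim> y \<sqsubseteq> z"
proof
  assume le: "x \<sqsubseteq> y \<squnion> z"
  show "x \<sqinter> \<sim> y \<sqsubseteq> z"
  proof (rule le_ultrafilterI)
    fix U assume "ultrafilter U" "x \<sqinter> \<sim> y \<in> U"
    then show "z \<in> U"
      using assms ultrafilter_mono[of U x "y \<squnion> z"] le by (simp add: ultrafilter_simps)
  qed (use assms complement_closed in auto)
next
  assume le: "x \<sqinter> \<sim> y \<sqsubseteq> z"
  show "x \<sqsubseteq> y \<squnion> z"
  proof (rule le_ultrafilterI)
    fix U assume "ultrafilter U" "x \<in> U"
    then show "y \<squnion> z \<in> U"
      using assms ultrafilter_mono[of U "x \<sqinter> \<sim> y" z] le by (auto simp: ultrafilter_simps)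
  qed (use assms in auto)
qed

end

section \<open>Soundness\<close>

context contact_algebra
begin

lemma prec_right_mono: "\<lbrakk>a \<prec> b; b \<sqsubseteq> c; a \<in> carrier L; b \<in> carrier L; c \<in> carrier L\<rbrakk> \<Longrightarrow> a \<prec> c"
  by (rule prec_mono[of a a b c]) auto

lemma prec_left_mono: "\<lbrakk>a \<sqsubseteq> b; b \<prec> c; a \<in> carrier L; b \<in> carrier L; c \<in> carrier L\<rbrakk> \<Longrightarrow> a \<prec> c"
  by (rule prec_mono[of a b c c]) auto

lemma prec_join_iff:
  "\<lbrakk>a \<in> carrier L; b \<in> carrier L; c \<in> carrier L\<rbrakk> \<Longrightarrow> a \<squnion> b \<prec> c \<longleftrightarrow> a \<prec> c \<and> b \<prec> c"
  by (meson join_closed join_left join_right prec_join prec_left_mono)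

lemma prec_meet_iff:
  "\<lbrakk>a \<in> carrier L; b \<in> carrier L; c \<in> carrier L\<rbrakk> \<Longrightarrow> a \<prec> b \<sqinter> c \<longleftrightarrow> a \<prec> b \<and> a \<prec> c"
  by (meson meet_closed meet_left meet_right prec_meet prec_right_mono)

lemma prec_complement_iff:
  "\<lbrakk>a \<in> carrier L; b \<in> carrier L\<rbrakk> \<Longrightarrow> \<sim> b \<prec> \<sim> a \<longleftrightarrow> a \<prec> b"
  by (metis complement_closed complement_complement prec_complement)

lemma top_prec_iff: "a \<in> carrier L \<Longrightarrow> \<top> \<prec> a \<longleftrightarrow> a = \<top>"
  using prec_imp_le[of \<top> a] prec_top by (auto intro: le_antisym)

lemma bottom_prec: "a \<in> carrier L \<Longrightarrow> \<bottom> \<prec> a"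
  by (rule prec_right_mono[OF prec_bottom]) auto

lemma prec_top_right: "a \<in> carrier L \<Longrightarrow> a \<prec> \<top>"
  by (rule prec_left_mono[OF _ prec_top]) auto

end

section \<open>The modal operator and the evaluation of formulas\<close>

context umcomp_algebra
begin

lemma dia_prec: "\<lbrakk>a \<prec> b; a \<in> carrier L; b \<in> carrier L\<rbrakk> \<Longrightarrow> \<diamondsuit> a \<prec> \<diamondsuit> b"
  using dia_additive[of a b a b] by (metis dia_closed le_iff_meet le_refl)

lemma dia_greatest:
  assumes "a \<in> carrier L" "c \<in> carrier L" "\<And>b. \<lbrakk>b \<in> carrier L; a \<prec> b\<rbrakk> \<Longrightarrow> c \<sqsubseteq> \<diamondsuit> b"
  shows "c \<sqsubseteq> \<diamondsuit> a"
  using dia_upper_continuous[OF assms(1)] assms by (auto simp: greatest_def Lower_def)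

text \<open>Whatever b is strictly below, a is strictly below too, so the meet that defines the
  value at a ranges over at least as many elements.\<close>

lemma dia_mono:
  assumes "a \<sqsubseteq> b" "a \<in> carrier L" "b \<in> carrier L"
  shows "\<diamondsuit> a \<sqsubseteq> \<diamondsuit> b"
proof (rule dia_greatest)
  fix c assume c: "c \<in> carrier L" "b \<prec> c"
  then have "a \<prec> c"
    using assms prec_left_mono by blast
  then show "\<diamondsuit> a \<sqsubseteq> \<diamondsuit> c"
    using assms c by (intro prec_imp_le dia_prec dia_closed)
qed (use assms dia_closed in auto)

text \<open>Subadditivity for the order, as (K) needs it. De Vries additivity bounds the left side
  by the join of the values at any a' and b' strictly above a and b. The two meets are taken one
  after the other, with residuation isolating the summand that varies.\<close>

lemma dia_join_le:
  assumes c: "a \<in> carrier L" "b \<in> carrier L"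
  shows "\<diamondsuit> (a \<squnion> b) \<sqsubseteq> \<diamondsuit> a \<squnion> \<diamondsuit> b"
proof -
  let ?j = "\<diamondsuit> (a \<squnion> b)"
  have d: "?j \<in> carrier L" "\<diamondsuit> a \<in> carrier L" "\<diamondsuit> b \<in> carrier L"
    using c by (simp_all add: dia_closed)
  have 1: "?j \<sqsubseteq> \<diamondsuit> b \<squnion> \<diamondsuit> a'" if a': "a' \<in> carrier L" "a \<prec> a'" for a'
  proof -
    have "?j \<sqinter> \<sim> (\<diamondsuit> a') \<sqsubseteq> \<diamondsuit> b"
    proof (rule dia_greatest)
      fix b' assume b': "b' \<in> carrier L" "b \<prec> b'"
      have "?j \<prec> \<diamondsuit> a' \<squnion> \<diamondsuit> b'"
        using a' b' c by (intro dia_additive)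
      then have "?j \<sqsubseteq> \<diamondsuit> a' \<squnion> \<diamondsuit> b'"
        using a' b' d by (intro prec_imp_le) (simp_all add: dia_closed)
      then show "?j \<sqinter> \<sim> (\<diamondsuit> a') \<sqsubseteq> \<diamondsuit> b'"
        using a' b' d by (simp add: le_join_iff_meet_complement dia_closed)
    qed (use a' c d in \<open>simp_all add: dia_closed complement_closed\<close>)
    then show ?thesis
      using a' d by (simp add: le_join_iff_meet_complement dia_closed join_comm[of _ "\<diamondsuit> b"])
  qed
  have "?j \<sqinter> \<sim> (\<diamondsuit> b) \<sqsubseteq> \<diamondsuit> a"
  proof (rule dia_greatest)
    fix a' assume a': "a' \<in> carrier L" "a \<prec> a'"
    from 1[OF a'] show "?j \<sqinter> \<sim> (\<diamondsuit> b) \<sqsubseteq> \<diamondsuit> a'"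
      using a' d by (simp add: le_join_iff_meet_complement dia_closed)
  qed (use c d in \<open>simp_all add: dia_closed complement_closed\<close>)
  then show ?thesis
    using d by (simp add: le_join_iff_meet_complement join_comm[of _ "\<diamondsuit> a"])
qed

lemma eval_closed: "range v \<subseteq> carrier L \<Longrightarrow> eval_fm L v \<phi> \<in> carrier L"
  by (induct \<phi>) (auto simp: complement_closed dia_closed)

lemma eval_fun_upd: "p \<notin> vars \<phi> \<Longrightarrow> eval_fm L (v(p := b)) \<phi> = eval_fm L v \<phi>"
  by (induct \<phi>) auto

lemma range_fun_upd: "\<lbrakk>range v \<subseteq> carrier L; b \<in> carrier L\<rbrakk> \<Longrightarrow> range (v(p := b)) \<subseteq> carrier L"
  by auto

text \<open>Membership of a strict implication does not depend on the ultrafilter, because its value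
  is top or bottom.\<close>

lemma eval_in_ultrafilter:
  assumes v: "range v \<subseteq> carrier L" and U: "ultrafilter U"
  shows "eval_fm L v Top \<in> U" "eval_fm L v Bot \<notin> U"
    "eval_fm L v (Neg \<phi>) \<in> U \<longleftrightarrow> eval_fm L v \<phi> \<notin> U"
    "eval_fm L v (\<phi> \<^bold>\<and> \<psi>) \<in> U \<longleftrightarrow> eval_fm L v \<phi> \<in> U \<and> eval_fm L v \<psi> \<in> U"
    "eval_fm L v (\<phi> \<^bold>\<or> \<psi>) \<in> U \<longleftrightarrow> eval_fm L v \<phi> \<in> U \<or> eval_fm L v \<psi> \<in> U"
    "eval_fm L v (\<phi> \<^bold>\<rightarrow> \<psi>) \<in> U \<longleftrightarrow> (eval_fm L v \<phi> \<in> U \<longrightarrow> eval_fm L v \<psi> \<in> U)"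
    "eval_fm L v (\<phi> \<^bold>\<leftrightarrow> \<psi>) \<in> U \<longleftrightarrow> (eval_fm L v \<phi> \<in> U \<longleftrightarrow> eval_fm L v \<psi> \<in> U)"
    "eval_fm L v (\<phi> \<leadsto> \<psi>) \<in> U \<longleftrightarrow> eval_fm L v \<phi> \<prec> eval_fm L v \<psi>"
  using eval_closed[OF v] U by (auto simp: ultrafilter_simps)

text \<open>The valuation must be general because the fresh-variable rules reassign p, and the
  ultrafilter because \<open>Approximate\<close> and \<open>Continuous\<close> use the hypothesis at
  ultrafilters other than U.\<close>

lemma soundness:
  assumes "ms2icu \<phi>" "range v \<subseteq> carrier L" "ultrafilter U"
  shows "eval_fm L v \<phi> \<in> U"
  using assms
proof (induct arbitrary: v U rule: ms2icu.induct)
  case (Taut \<alpha> \<sigma>)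
  have "truth (\<lambda>n. eval_fm L v (\<sigma> n) \<in> U) \<beta> \<longleftrightarrow> eval_fm L v (inst \<sigma> \<beta>) \<in> U" for \<beta>
    using Taut by (induct \<beta>) (simp_all only: truth.simps inst.simps eval_in_ultrafilter simp_thms)
  then show ?case
    using Taut unfolding tautology_def by blast
next
  case (Repl \<phi> \<phi>' \<psi> \<psi>')
  \<comment> \<open>The hypotheses hold at every ultrafilter, so the values coincide; agreement at U
    alone would say nothing about \<prec>.\<close>
  have "eval_fm L v \<phi> = eval_fm L v \<phi>'" "eval_fm L v \<psi> = eval_fm L v \<psi>'"
    using Repl eval_closed[of v] by (auto intro!: eq_ultrafilterI simp: eval_in_ultrafilter simp del: eval_fm.simps)
  then show ?case
    using Repl by (simp add: eval_in_ultrafilter del: eval_fm.simps)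
next
  case (MP \<phi> \<psi>)
  then show ?case by (simp add: eval_in_ultrafilter del: eval_fm.simps)
next
  case (NecAll \<phi>)
  have "eval_fm L v \<phi> = \<top>"
    using NecAll eval_closed[of v] by (intro eq_ultrafilterI) (auto simp: ultrafilter_simps)
  then show ?case
    using NecAll by (simp add: prec_top ultrafilter_simps)
next
  case (NecBox \<phi>)
  have "eval_fm L v \<phi> = \<top>"
    using NecBox eval_closed[of v] by (intro eq_ultrafilterI) (auto simp: ultrafilter_simps)
  moreover have "\<sim> \<top> = \<bottom>"
    by (rule eq_ultrafilterI) (auto simp: ultrafilter_simps)
  ultimately show ?case
    using NecBox by (simp add: dia_bottom ultrafilter_simps)
next
  case (K \<phi> \<psi>)
  let ?a = "eval_fm L v \<phi>" and ?b = "eval_fm L v \<psi>"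
  have c: "?a \<in> carrier L" "?b \<in> carrier L"
    using eval_closed K by auto
  \<comment> \<open>Dual form of modus ponens: where \<open>b\<close> fails, either the implication
    or \<open>a\<close> fails.\<close>
  have "\<sim> ?b \<sqsubseteq> \<sim> (\<sim> ?a \<squnion> ?b) \<squnion> \<sim> ?a"
    using c by (intro le_ultrafilterI) (auto simp: ultrafilter_simps)
  then have "\<diamondsuit> (\<sim> ?b) \<sqsubseteq> \<diamondsuit> (\<sim> (\<sim> ?a \<squnion> ?b) \<squnion> \<sim> ?a)"
    using c by (simp add: dia_mono complement_closed)
  also have "\<dots> \<sqsubseteq> \<diamondsuit> (\<sim> (\<sim> ?a \<squnion> ?b)) \<squnion> \<diamondsuit> (\<sim> ?a)"
    using c by (simp add: dia_join_le complement_closed)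
  finally have "\<diamondsuit> (\<sim> ?b) \<sqsubseteq> \<diamondsuit> (\<sim> (\<sim> ?a \<squnion> ?b)) \<squnion> \<diamondsuit> (\<sim> ?a)"
    using c by (simp add: dia_closed complement_closed)
  then show ?case
    using c K ultrafilter_mono[of U "\<diamondsuit> (\<sim> ?b)" "\<diamondsuit> (\<sim> (\<sim> ?a \<squnion> ?b)) \<squnion> \<diamondsuit> (\<sim> ?a)"]
    by (auto simp: ultrafilter_simps dia_closed)
next
  case (Add \<phi> \<psi>)
  let ?a = "eval_fm L v \<phi>" and ?b = "eval_fm L v \<psi>"
  have c: "?a \<in> carrier L" "?b \<in> carrier L"
    using eval_closed Add by auto
  have "\<sim> (\<diamondsuit> (\<sim> ?a)) \<prec> \<sim> (\<diamondsuit> (\<sim> ?b))" if "?a \<prec> ?b"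
    using that c by (simp add: prec_complement_iff dia_prec dia_closed complement_closed)
  then show ?case
    using Add by (simp add: eval_in_ultrafilter(6,8) del: eval_fm.simps(7,9))
next
  case (Interpolate \<phi> p \<psi> \<chi>)
  have "eval_fm L v \<chi> \<in> U" if prec: "eval_fm L v \<phi> \<prec> eval_fm L v \<psi>"
  proof -
    obtain b where b: "b \<in> carrier L" "eval_fm L v \<phi> \<prec> b" "b \<prec> eval_fm L v \<psi>"
      using prec_interpolate[OF _ _ prec] eval_closed Interpolate by blast
    then show ?thesis
      using Interpolate(2)[OF range_fun_upd[OF Interpolate(4) b(1), of p] Interpolate(5)] Interpolate(3,5)
      by (simp add: eval_in_ultrafilter[OF range_fun_upd[OF Interpolate(4) b(1)] Interpolate(5)]
          eval_fun_upd del: eval_fm.simps(2-) fun_upd_apply) simp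
  qed
  then show ?case
    using Interpolate by (simp add: eval_in_ultrafilter del: eval_fm.simps)
next
  case (Approximate p \<phi> \<chi>)
  let ?a = "eval_fm L v \<phi>" and ?d = "eval_fm L v \<chi>"
  have c: "?a \<in> carrier L" "?d \<in> carrier L"
    using eval_closed Approximate by auto
  \<comment> \<open>Otherwise a nonzero b is strictly below this meet. With p assigned b, the
    premise of the rule fails at any ultrafilter W containing b.\<close>
  have "?a \<sqinter> \<sim> ?d = \<bottom>"
  proof (rule ccontr)
    assume "?a \<sqinter> \<sim> ?d \<noteq> \<bottom>"
    then obtain b where b: "b \<in> carrier L" "b \<noteq> \<bottom>" "b \<prec> ?a \<sqinter> \<sim> ?d"
      using prec_approximate[of "?a \<sqinter> \<sim> ?d"] c by (auto simp: complement_closed)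
    then obtain W where W: "ultrafilter W" "b \<in> W"
      using ex_ultrafilter by blast
    have "?a \<sqinter> \<sim> ?d \<in> W"
      using b c by (intro ultrafilter_mono[OF W] prec_imp_le) (simp_all add: complement_closed)
    moreover have "b \<prec> ?a"
      using b c by (simp add: prec_meet_iff complement_closed)
    ultimately show False
      using Approximate(2)[OF range_fun_upd[OF Approximate(4) b(1), of p] W(1)] Approximate(3) W c
      by (simp add: eval_in_ultrafilter[OF range_fun_upd[OF Approximate(4) b(1)] W(1)]
          eval_fun_upd ultrafilter_simps fun_upd_same del: eval_fm.simps(2-) fun_upd_apply)
  qed
  then have "?a \<in> U \<longrightarrow> ?d \<in> U"
    using Approximate(5) c by (metis ultrafilter_simps)
  then show ?case
    using Approximate by (simp add: eval_in_ultrafilter del: eval_fm.simps)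
next
  case (Continuous p \<phi> \<psi>)
  let ?a = "eval_fm L v \<phi>" and ?d = "eval_fm L v \<psi>"
  have c: "?a \<in> carrier L" "?d \<in> carrier L"
    using eval_closed Continuous by auto
  \<comment> \<open>Contrapositive of the conclusion. For each b strictly above the complement of
    \<open>?a\<close>, the variable p is assigned the complement of b, which is strictly below
    \<open>?a\<close>; then \<open>Box (Var p)\<close> has the complement of
    \<open>\<diamondsuit> b\<close> as its value.\<close>
  have "\<sim> ?d \<sqsubseteq> \<diamondsuit> (\<sim> ?a)"
  proof (rule dia_greatest)
    fix b assume b: "b \<in> carrier L" "\<sim> ?a \<prec> b"
    then have "\<sim> b \<prec> ?a"
      using c by (metis complement_closed complement_complement prec_complement)
    show "\<sim> ?d \<sqsubseteq> \<diamondsuit> b"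
    proof (rule le_ultrafilterI)
      fix W assume W: "ultrafilter W" "\<sim> ?d \<in> W"
      have r: "range (v(p := \<sim> b)) \<subseteq> carrier L"
        using Continuous(4) b complement_closed by auto
      have "eval_fm L (v(p := \<sim> b)) (Box (Var p)) = \<sim> (\<diamondsuit> b)"
        using b by (simp add: complement_complement)
      then show "\<diamondsuit> b \<in> W"
        using Continuous(2)[OF r W(1)] Continuous(3) W c b \<open>\<sim> b \<prec> ?a\<close>
        by (simp add: eval_in_ultrafilter[OF r W(1)] eval_fun_upd ultrafilter_simps dia_closed
            fun_upd_same del: eval_fm.simps(2-) fun_upd_apply)
    qed (use b c in \<open>auto simp: complement_closed dia_closed\<close>)
  qed (use c in \<open>auto simp: complement_closed\<close>)
  then show ?case
    using Continuous(5) c ultrafilter_mono[of U "\<sim> ?d" "\<diamondsuit> (\<sim> ?a)"]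
    by (auto simp: ultrafilter_simps dia_closed)
next
  case (A11 \<phi>)
  have "\<sim> \<top> = \<bottom>"
    by (rule eq_ultrafilterI) (auto simp: ultrafilter_simps)
  then show ?case
    using A11 by (auto simp: eval_in_ultrafilter(6,8) prec_bottom ultrafilter_simps simp del: eval_fm.simps(7))
next
  case (A9 \<phi>)
  have "\<sim> \<bottom> = \<top>"
    by (rule eq_ultrafilterI) (auto simp: ultrafilter_simps)
  then show ?case
    using A9 by (auto simp: ultrafilter_simps prec_top)
next
  case (A10 \<phi> \<psi>)
  \<comment> \<open>The ultrafilter at hand rules out the one-element algebra, so
    \<open>\<top> \<prec> \<bottom>\<close> is impossible.\<close>
  then have "\<bottom> \<noteq> \<top>"
    using ultrafilter_top ultrafilter_bottom by metis
  then show ?case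
    using A10 by (simp add: eval_in_ultrafilter(7) del: eval_fm.simps(8))
      (simp add: top_prec_iff)
next
  case (A8 \<phi>)
  then show ?case
    by (auto simp: ultrafilter_simps prec_top)
next
  case (A4 \<phi> \<psi>)
  then show ?case
    using prec_imp_le[of "eval_fm L v \<phi>" "eval_fm L v \<psi>"] eval_closed ultrafilter_mono
    by (auto simp: eval_in_ultrafilter simp del: eval_fm.simps)
next
  case (A1 \<phi>)
  then show ?case
    by (simp add: bottom_prec prec_top_right eval_closed ultrafilter_simps)
next
  case (A2 \<phi> \<psi> \<chi>)
  then show ?case
    by (simp add: eval_in_ultrafilter(4,7,8) del: eval_fm.simps(5,8,9))
      (simp add: prec_join_iff eval_closed ultrafilter_simps)
next
  case (A3 \<phi> \<psi> \<chi>)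
  then show ?case
    by (simp add: eval_in_ultrafilter(4,7,8) del: eval_fm.simps(8,9))
      (simp add: prec_meet_iff eval_closed ultrafilter_simps)
next
  case (A5 \<phi> \<psi>)
  then show ?case
    by (simp add: eval_in_ultrafilter(7,8) del: eval_fm.simps(8,9))
      (simp add: prec_complement_iff eval_closed)
qed

lemma eval_conjs:
  "(\<And>\<gamma>. \<gamma> \<in> set \<gamma>s \<Longrightarrow> eval_fm L v \<gamma> = \<top>) \<Longrightarrow> eval_fm L v (conjs \<gamma>s) = \<top>"
  by (induct \<gamma>s rule: conjs.induct) (auto simp: meet_top)

end

theorem derives_sound:
  assumes "\<Gamma> \<turnstile>\<^sub>M\<^sub>S \<phi>"
  shows "umcomp_consequence TYPE('a) \<Gamma> \<phi>"
  unfolding umcomp_consequence_def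
proof (intro allI impI)
  fix L :: "'a modal_contact_structure" and v
  assume "umcomp_algebra L" and v: "range v \<subseteq> carrier L" and g: "\<forall>\<gamma>\<in>\<Gamma>. eval_fm L v \<gamma> = \<top>\<^bsub>L\<^esub>"
  then interpret umcomp_algebra L by simp
  obtain \<gamma>s where s: "set \<gamma>s \<subseteq> \<Gamma>" and d: "ms2icu (All (conjs \<gamma>s) \<^bold>\<rightarrow> \<phi>)"
    using assms unfolding derives_def by blast
  have "eval_fm L v (conjs \<gamma>s) = \<top>\<^bsub>L\<^esub>"
    using g s by (intro eval_conjs) auto
  \<comment> \<open>The one-element algebra has no ultrafilters; there the equality below follows
    vacuously.\<close>
  then have "eval_fm L v \<phi> \<in> U" if "ultrafilter U" for U
    using soundness[OF d v that] v that by (simp add: eval_in_ultrafilter(6,8) prec_top del: eval_fm.simps(7,9))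
  then show "eval_fm L v \<phi> = \<top>\<^bsub>L\<^esub>"
    using eval_closed[OF v] by (intro eq_ultrafilterI) (auto simp: ultrafilter_simps)
qed

section \<open>The Lindenbaum algebra of a saturated theory\<close>

text \<open>The map \<open>h\<close> names equivalence classes by elements of the ambient type and
  is not injective on formulas. Relations therefore hold as soon as some representatives are
  related, and the operator works on a chosen representative.\<close>

definition lindenbaum :: "(fm \<Rightarrow> bool) \<Rightarrow> (fm \<Rightarrow> 'a) \<Rightarrow> 'a modal_contact_structure" where
  "lindenbaum P h = \<lparr>carrier = range h, eq = (=),
    le = (\<lambda>x y. \<exists>a b. x = h a \<and> y = h b \<and> P (a \<^bold>\<rightarrow> b)),
    prec = (\<lambda>x y. \<exists>a b. x = h a \<and> y = h b \<and> P (a \<leadsto> b)),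
    dia = (\<lambda>x. h (Neg (Box (Neg (SOME a. x = h a)))))\<rparr>"

locale lindenbaum_algebra = saturated_theory P for P +
  fixes h :: "fm \<Rightarrow> 'a" and L (structure)
  assumes h_eq: "h a = h b \<longleftrightarrow> P (a \<^bold>\<leftrightarrow> b)"
    and L_def: "L = lindenbaum P h"
begin

lemma carrier_L: "carrier L = range h"
  by (simp add: L_def lindenbaum_def)

lemma eq_L: "(.=) = (=)"
  by (simp add: L_def lindenbaum_def)

lemma h_closed [simp, intro]: "h a \<in> carrier L"
  by (simp add: carrier_L)

lemma carrier_cases:
  assumes "x \<in> carrier L"
  obtains a where "x = h a"
  using assms by (auto simp: carrier_L)

lemma le_h: "h a \<sqsubseteq> h b \<longleftrightarrow> P (a \<^bold>\<rightarrow> b)"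
proof
  assume "h a \<sqsubseteq> h b"
  then obtain a' b' where "P (a \<^bold>\<leftrightarrow> a')" "P (b \<^bold>\<leftrightarrow> b')" "P (a' \<^bold>\<rightarrow> b')"
    by (auto simp: L_def lindenbaum_def h_eq)
  then show "P (a \<^bold>\<rightarrow> b)"
    by (rule prop3) auto
qed (auto simp: L_def lindenbaum_def)

text \<open>Independence of representatives. These are equivalent in \<open>P\<close> only, so
  monotonicity of \<leadsto> on both sides takes the place of replacement.\<close>

lemma prec_h: "h a \<prec> h b \<longleftrightarrow> P (a \<leadsto> b)"
proof
  assume "h a \<prec> h b"
  then obtain a' b' where *: "P (a \<^bold>\<leftrightarrow> a')" "P (b \<^bold>\<leftrightarrow> b')" "P (a' \<leadsto> b')"
    by (auto simp: L_def lindenbaum_def h_eq)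
  have "P (a \<^bold>\<rightarrow> a')" "P (b' \<^bold>\<rightarrow> b)"
    by (rule prop1[OF *(1)], simp, rule prop1[OF *(2)], simp)
  then show "P (a \<leadsto> b)"
    using *(3) by (blast intro: simp_left_mono simp_right_mono)
qed (auto simp: L_def lindenbaum_def)

lemma h_eqI: "\<lbrakk>P (a \<^bold>\<rightarrow> b); P (b \<^bold>\<rightarrow> a)\<rbrakk> \<Longrightarrow> h a = h b"
  unfolding h_eq by (rule prop2[of "a \<^bold>\<rightarrow> b" "b \<^bold>\<rightarrow> a"]) auto

lemma h_taut_eq: "(\<And>e. bval e a = bval e b) \<Longrightarrow> h a = h b"
  by (rule h_eqI; rule taut; simp)

text \<open>The chosen representative does not matter, because \<open>Box\<close> is monotone for
  implications of \<open>P\<close>.\<close>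

lemma dia_h: "\<diamondsuit> (h a) = h (Neg (Box (Neg a)))"
proof -
  define a' where "a' = (SOME b. h a = h b)"
  have "h a = h a'"
    unfolding a'_def by (rule someI[of _ a]) simp
  then have *: "P (a \<^bold>\<leftrightarrow> a')"
    by (simp add: h_eq)
  have "P (Neg a \<^bold>\<rightarrow> Neg a')" "P (Neg a' \<^bold>\<rightarrow> Neg a)"
    by (rule prop1[OF *], simp)+
  then have "P (Box (Neg a) \<^bold>\<rightarrow> Box (Neg a'))" "P (Box (Neg a') \<^bold>\<rightarrow> Box (Neg a))"
    by (simp_all add: box_mono)
  then have "h (Neg (Box (Neg a))) = h (Neg (Box (Neg a')))"
    unfolding h_eq by (rule prop2) auto
  then show ?thesis
    by (simp add: L_def lindenbaum_def a'_def)
qed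

lemma least_L:
  assumes "P (a \<^bold>\<rightarrow> c)" "P (b \<^bold>\<rightarrow> c)" "\<And>d. \<lbrakk>P (a \<^bold>\<rightarrow> d); P (b \<^bold>\<rightarrow> d)\<rbrakk> \<Longrightarrow> P (c \<^bold>\<rightarrow> d)"
  shows "least L (h c) (Upper L {h a, h b})"
  using assms unfolding least_def Upper_def
  by (auto simp: le_h elim!: carrier_cases)

lemma greatest_L:
  assumes "P (c \<^bold>\<rightarrow> a)" "P (c \<^bold>\<rightarrow> b)" "\<And>d. \<lbrakk>P (d \<^bold>\<rightarrow> a); P (d \<^bold>\<rightarrow> b)\<rbrakk> \<Longrightarrow> P (d \<^bold>\<rightarrow> c)"
  shows "greatest L (h c) (Lower L {h a, h b})"
  using assms unfolding greatest_def Lower_def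
  by (auto simp: le_h elim!: carrier_cases)

lemma least_disj: "least L (h (a \<^bold>\<or> b)) (Upper L {h a, h b})"
proof (rule least_L)
  fix d assume "P (a \<^bold>\<rightarrow> d)" "P (b \<^bold>\<rightarrow> d)"
  then show "P (a \<^bold>\<or> b \<^bold>\<rightarrow> d)"
    by (rule prop2) auto
qed (rule taut, simp)+

lemma greatest_conj: "greatest L (h (a \<^bold>\<and> b)) (Lower L {h a, h b})"
proof (rule greatest_L)
  fix d assume "P (d \<^bold>\<rightarrow> a)" "P (d \<^bold>\<rightarrow> b)"
  then show "P (d \<^bold>\<rightarrow> a \<^bold>\<and> b)"
    by (rule prop2) auto
qed (rule taut, simp)+

lemma least_bot: "least L (h Bot) (carrier L)"
  unfolding least_def by (auto simp: carrier_L le_h intro: taut)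

lemma greatest_top: "greatest L (h Top) (carrier L)"
  unfolding greatest_def by (auto simp: carrier_L le_h intro: taut)

lemma bounded_lattice_L: "bounded_lattice L"
proof
  fix x y z assume "x \<in> carrier L" "y \<in> carrier L" "z \<in> carrier L"
  then obtain a b c where abc: "x = h a" "y = h b" "z = h c"
    by (auto elim!: carrier_cases)
  show "x \<sqsubseteq> x"
    unfolding abc le_h by (rule taut) simp
  show "x .= y" if "x \<sqsubseteq> y" "y \<sqsubseteq> x"
    using that unfolding abc le_h eq_L by (rule h_eqI)
  show "x \<sqsubseteq> z" if "x \<sqsubseteq> y" "y \<sqsubseteq> z"
    using that unfolding abc le_h by (rule prop2) auto
  show "\<exists>s. least L s (Upper L {x, y})" "\<exists>s. greatest L s (Lower L {x, y})"
    unfolding abc using least_disj greatest_conj by blast+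
qed (auto simp: eq_L intro: least_bot greatest_top)

sublocale bl: bounded_lattice L
  by (rule bounded_lattice_L)

lemma join_h: "h a \<squnion> h b = h (a \<^bold>\<or> b)"
  using bl.least_unique[OF _ least_disj[of a b]] bl.sup_of_two_least[of "h a" "h b"]
  by (simp add: join_def)

lemma meet_h: "h a \<sqinter> h b = h (a \<^bold>\<and> b)"
  using bl.greatest_unique[OF _ greatest_conj[of a b]] bl.inf_of_two_greatest[of "h a" "h b"]
  by (simp add: meet_def)

lemma top_h: "\<top> = h Top"
  using bl.greatest_unique[OF bl.top_greatest greatest_top] .

lemma bot_h: "\<bottom> = h Bot"
  using bl.least_unique[OF bl.bottom_least least_bot] .

lemma boolean_lattice_L: "boolean_lattice L"
proof
  fix x y z assume "x \<in> carrier L" "y \<in> carrier L" "z \<in> carrier L"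
  then obtain a b c where abc: "x = h a" "y = h b" "z = h c"
    by (auto elim!: carrier_cases)
  show "x \<sqinter> (y \<squnion> z) = (x \<sqinter> y) \<squnion> (x \<sqinter> z)"
    unfolding abc meet_h join_h by (rule h_taut_eq) auto
next
  fix x assume "x \<in> carrier L"
  then obtain a where a: "x = h a"
    by (auto elim!: carrier_cases)
  have "x \<sqinter> h (Neg a) = \<bottom>" "x \<squnion> h (Neg a) = \<top>"
    unfolding a meet_h join_h top_h bot_h by (rule h_taut_eq, simp)+
  then show "\<exists>y\<in>carrier L. x \<sqinter> y = \<bottom> \<and> x \<squnion> y = \<top>"
    by blast
qed

sublocale boolean_lattice L
  by (rule boolean_lattice_L)

text \<open>The two equations characterising the complement, read in \<open>P\<close>, already force
  equivalence with the negation.\<close>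

lemma complement_h: "\<sim> (h a) = h (Neg a)"
proof -
  obtain b where b: "\<sim> (h a) = h b"
    using complement_closed[OF h_closed] by (auto elim!: carrier_cases)
  have "P ((a \<^bold>\<and> b) \<^bold>\<leftrightarrow> Bot)" "P ((a \<^bold>\<or> b) \<^bold>\<leftrightarrow> Top)"
    using meet_complement[OF h_closed, of a] join_complement[OF h_closed, of a]
    by (simp_all add: b meet_h join_h top_h bot_h h_eq)
  then show ?thesis
    unfolding b h_eq by (rule prop2) auto
qed

lemma compingent_L: "compingent_algebra L"
proof
  show "\<bottom> \<prec> \<bottom>" "\<top> \<prec> \<top>"
    by (simp_all add: top_h bot_h prec_h bot_simp simp_top)
next
  fix x y z assume "x \<in> carrier L" "y \<in> carrier L" "z \<in> carrier L"
  then obtain a b c where abc: "x = h a" "y = h b" "z = h c"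
    by (auto elim!: carrier_cases)
  show "x \<prec> y \<sqinter> z" if "x \<prec> y" "x \<prec> z"
    using that by (simp add: abc meet_h prec_h simp_conj_iff)
  show "x \<squnion> y \<prec> z" if "x \<prec> z" "y \<prec> z"
    using that by (simp add: abc join_h prec_h simp_disj_iff)
next
  fix x y z w assume "x \<in> carrier L" "y \<in> carrier L" "z \<in> carrier L" "w \<in> carrier L"
  then obtain a b c d where abcd: "x = h a" "y = h b" "z = h c" "w = h d"
    by (auto elim!: carrier_cases)
  show "x \<prec> w" if "x \<sqsubseteq> y" "y \<prec> z" "z \<sqsubseteq> w"
    using that unfolding abcd prec_h le_h by (blast intro: simp_left_mono simp_right_mono)
next
  fix x y assume "x \<in> carrier L" "y \<in> carrier L"
  then obtain a b where ab: "x = h a" "y = h b"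
    by (auto elim!: carrier_cases)
  show "x \<sqsubseteq> y" if "x \<prec> y"
    using that by (simp add: ab prec_h le_h simp_imp)
  show "\<sim> y \<prec> \<sim> x" if "x \<prec> y"
    using that by (simp add: ab prec_h complement_h simp_neg)
  show "\<exists>c\<in>carrier L. x \<prec> c \<and> c \<prec> y" if xy: "x \<prec> y"
  proof -
    obtain c where "P (a \<leadsto> c)" "P (c \<leadsto> b)"
      using interpolant[of a b] xy by (auto simp: ab prec_h)
    then show ?thesis
      by (intro bexI[of _ "h c"]) (simp_all add: ab prec_h)
  qed
next
  fix x assume "x \<in> carrier L" "x \<noteq> \<bottom>"
  then obtain a where a: "x = h a" "h a \<noteq> h Bot"
    by (auto simp: bot_h elim!: carrier_cases)
  \<comment> \<open>The approximant is taken relative to \<open>Bot\<close>: a formula strictly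
    below a that is not below bottom.\<close>
  have "\<not> P (a \<^bold>\<rightarrow> Bot)"
  proof
    assume "P (a \<^bold>\<rightarrow> Bot)"
    then have "h a = h Bot"
      by (rule h_eqI) (rule taut, simp)
    then show False
      using a by blast
  qed
  then obtain c where c: "P (c \<leadsto> a)" "\<not> P (c \<^bold>\<rightarrow> Bot)"
    using approximant by blast
  have "h c \<noteq> h Bot"
  proof
    assume "h c = h Bot"
    then have "P (c \<^bold>\<leftrightarrow> Bot)"
      by (simp add: h_eq)
    then have "P (c \<^bold>\<rightarrow> Bot)"
      by (rule prop1) simp
    then show False
      using c by blast
  qed
  then show "\<exists>b\<in>carrier L. b \<noteq> \<bottom> \<and> b \<prec> x"
    using c by (intro bexI[of _ "h c"]) (simp_all add: a bot_h prec_h)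
qed

lemma dia_mono_imp:
  assumes "P (a \<^bold>\<rightarrow> b)"
  shows "P (Neg (Box (Neg a)) \<^bold>\<rightarrow> Neg (Box (Neg b)))"
proof -
  have "P (Neg b \<^bold>\<rightarrow> Neg a)"
    by (rule prop1[OF assms]) auto
  then show ?thesis
    by (rule prop1[OF box_mono]) auto
qed

lemma dia_prec_simp:
  "P (a \<leadsto> b) \<Longrightarrow> P (Neg (Box (Neg a)) \<leadsto> Neg (Box (Neg b)))"
  by (intro simp_neg mp[OF ax[OF ms2icu.Add]])

lemma dia_disj_imp: "P (Neg (Box (Neg (a \<^bold>\<or> b))) \<^bold>\<rightarrow> Neg (Box (Neg a)) \<^bold>\<or> Neg (Box (Neg b)))"
proof -
  have "P (Neg a \<^bold>\<rightarrow> (Neg b \<^bold>\<rightarrow> Neg (a \<^bold>\<or> b)))"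
    by (rule taut) simp
  then show ?thesis
    by (rule prop2[OF box_mono ax[OF ms2icu.K[of "Neg b" "Neg (a \<^bold>\<or> b)"]]]) auto
qed

lemma umcomp_L: "umcomp_algebra L"
proof -
  interpret compingent_algebra L
    by (rule compingent_L)
  show ?thesis
  proof
    show "\<diamondsuit> x \<in> carrier L" if "x \<in> carrier L" for x
      using that by (auto simp: dia_h elim!: carrier_cases)
    have "P (Neg Bot)"
      by (rule taut) simp
    then have "P (Box (Neg Bot))"
      by (rule nec_box)
    then show "\<diamondsuit> \<bottom> = \<bottom>"
      unfolding bot_h dia_h h_eq by (rule prop1) simp
  next
    fix x y x' y' assume c: "x \<in> carrier L" "y \<in> carrier L" "x' \<in> carrier L" "y' \<in> carrier L"
      and prec: "x \<prec> y" "x' \<prec> y'"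
    obtain a b a' b' where ab: "x = h a" "y = h b" "x' = h a'" "y' = h b'"
      using c by (auto elim!: carrier_cases)
    \<comment> \<open>Both left sides lie strictly below the same disjunction, so their join does.
      (Add) applies to that single strict implication, and (K) distributes the operator over the
      disjunction afterwards.\<close>
    have "P (a \<leadsto> (b \<^bold>\<or> b'))"
      using prec(1) unfolding ab prec_h by (rule simp_right_mono) (rule taut, simp)
    moreover have "P (a' \<leadsto> (b \<^bold>\<or> b'))"
      using prec(2) unfolding ab prec_h by (rule simp_right_mono) (rule taut, simp)
    ultimately have "P ((a \<^bold>\<or> a') \<leadsto> (b \<^bold>\<or> b'))"
      by (simp add: simp_disj_iff)
    then show "\<diamondsuit> (x \<squnion> x') \<prec> \<diamondsuit> y \<squnion> \<diamondsuit> y'"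
      unfolding ab join_h dia_h prec_h by (rule simp_right_mono[OF dia_prec_simp dia_disj_imp])
  next
    fix x assume "x \<in> carrier L"
    then obtain a where a: "x = h a"
      by (auto elim!: carrier_cases)
    let ?D = "{\<diamondsuit> b |b. b \<in> carrier L \<and> x \<prec> b}"
    have lower: "\<diamondsuit> x \<sqsubseteq> \<diamondsuit> y" if y: "y \<in> carrier L" "x \<prec> y" for y
    proof -
      obtain b where b: "y = h b"
        using y(1) by (rule carrier_cases)
      show ?thesis
        using y(2) unfolding a b dia_h le_h prec_h by (intro dia_mono_imp simp_imp)
    qed
    have greatest: "y \<sqsubseteq> \<diamondsuit> x" if y: "y \<in> carrier L" "\<And>b. x \<prec> h b \<Longrightarrow> y \<sqsubseteq> \<diamondsuit> (h b)" for y
    proof -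
      obtain c where c: "y = h c"
        using y(1) by (rule carrier_cases)
      \<comment> \<open>This is the inequality with negations moved across. If it fails,
        \<open>box_approximant\<close> gives d strictly below \<open>Neg a\<close>; then a is
        strictly below \<open>Neg d\<close>, and the assumed bound at \<open>Neg d\<close>
        contradicts the choice of d.\<close>
      have "P (Box (Neg a) \<^bold>\<rightarrow> Neg c)"
      proof (rule ccontr)
        assume "\<not> P (Box (Neg a) \<^bold>\<rightarrow> Neg c)"
        then obtain d where d: "P (d \<leadsto> Neg a)" "\<not> P (Box d \<^bold>\<rightarrow> Neg c)"
          using box_approximant by blast
        have "P (a \<leadsto> Neg d)"
          by (rule taut_cong_simp[OF simp_neg[OF d(1)]]) simp_all
        then have "P (c \<^bold>\<rightarrow> Neg (Box (Neg (Neg d))))"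
          using y(2)[of "Neg d"] by (simp add: a c prec_h dia_h le_h)
        moreover have "P (Box d \<^bold>\<rightarrow> Box (Neg (Neg d)))"
          by (rule box_mono, rule taut) simp
        ultimately have "P (Box d \<^bold>\<rightarrow> Neg c)"
          by (rule prop2) auto
        then show False
          using d by blast
      qed
      then show ?thesis
        unfolding a c dia_h le_h by (rule prop1) auto
    qed
    show "greatest L (\<diamondsuit> x) (Lower L ?D)"
      unfolding greatest_def
    proof (intro conjI ballI)
      show "\<diamondsuit> x \<in> Lower L ?D"
        using lower by (auto simp: Lower_def a dia_h)
    next
      fix y assume y: "y \<in> Lower L ?D"
      show "y \<sqsubseteq> \<diamondsuit> x"
      proof (rule greatest)
        show "y \<in> carrier L"
          using y by (simp add: Lower_def)
        show "y \<sqsubseteq> \<diamondsuit> (h b)" if "x \<prec> h b" for b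
        proof -
          have "\<diamondsuit> (h b) \<in> carrier L"
            by (simp add: dia_h)
          then show ?thesis
            using y that h_closed unfolding Lower_def by blast
        qed
      qed
    qed (simp add: Lower_def)
  qed
qed

text \<open>Truth lemma. The renaming sits in the valuation, so the original formulas are evaluated
  although \<open>P\<close> concerns their renamed copies. The case of \<leadsto> uses
  \<open>neg_complete\<close>: an underivable strict implication must have value bottom.\<close>

lemma eval_h: "eval_fm L (\<lambda>n. h (Var (f n))) \<phi> = h (map_form f \<phi>)"
proof (induct \<phi>)
  case (Imp \<phi> \<psi>)
  then show ?case
    by (simp add: complement_h join_h) (rule h_taut_eq, simp)
next
  case (Iff \<phi> \<psi>)
  then show ?case
    by (simp add: complement_h join_h meet_h) (rule h_taut_eq, auto)
next
  case (SImp \<phi> \<psi>)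
  let ?s = "map_form f \<phi> \<leadsto> map_form f \<psi>"
  have "h ?s = h Top" if "P ?s"
    unfolding h_eq using that by (rule prop1) simp
  moreover have "h ?s = h Bot" if "\<not> P ?s"
  proof -
    have "P (Neg ?s)"
      using that neg_complete by blast
    then show ?thesis
      unfolding h_eq by (rule prop1) simp
  qed
  ultimately show ?case
    using SImp by (simp add: prec_h top_h bot_h)
next
  case (Box \<phi>)
  have "P (Box (map_form f \<phi>) \<^bold>\<rightarrow> Box (Neg (Neg (map_form f \<phi>))))"
    "P (Box (Neg (Neg (map_form f \<phi>))) \<^bold>\<rightarrow> Box (map_form f \<phi>))"
    by (rule box_mono, rule taut, simp)+
  then have "h (Neg (Neg (Box (Neg (Neg (map_form f \<phi>)))))) = h (Box (map_form f \<phi>))"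
    unfolding h_eq by (rule prop2) auto
  then show ?case
    using Box by (simp add: complement_h dia_h)
qed (simp_all add: top_h bot_h complement_h meet_h join_h)

end

text \<open>Equivalent formulas satisfy the same predicate under \<open>SOME\<close>, hence receive
  the same canonical formula. Its code is then injected into the ambient type, which is where
  infinity is used.\<close>

lemma ex_representatives:
  assumes inf: "infinite (UNIV :: 'a set)" and P: "normal_theory P"
  shows "\<exists>h :: fm \<Rightarrow> 'a. \<forall>a b. h a = h b \<longleftrightarrow> P (a \<^bold>\<leftrightarrow> b)"
proof -
  interpret normal_theory P
    by (rule P)
  obtain f :: "nat \<Rightarrow> 'a" where f: "inj f"
    using infinite_countable_subset[OF inf] by blast
  let ?r = "\<lambda>a. SOME b. P (a \<^bold>\<leftrightarrow> b)"
  have r: "P (a \<^bold>\<leftrightarrow> ?r a)" for a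
    by (rule someI[of _ a]) (rule taut, simp)
  have "?r a = ?r b \<longleftrightarrow> P (a \<^bold>\<leftrightarrow> b)" for a b
  proof
    assume "?r a = ?r b"
    then have "P (b \<^bold>\<leftrightarrow> ?r a)"
      using r[of b] by (simp only:)
    then show "P (a \<^bold>\<leftrightarrow> b)"
      by (rule prop2[OF r[of a]]) simp
  next
    assume ab: "P (a \<^bold>\<leftrightarrow> b)"
    have "P (a \<^bold>\<leftrightarrow> c) \<longleftrightarrow> P (b \<^bold>\<leftrightarrow> c)" for c
      by (rule iffI; erule prop2[OF ab]; simp)
    then show "?r a = ?r b"
      by simp
  qed
  then show ?thesis
    using f by (intro exI[of _ "\<lambda>a. f (to_nat (?r a))"]) (simp add: inj_eq)
qed

theorem theorem3p11:
  fixes \<Gamma> :: "fm set" and \<phi> :: fm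
  assumes "infinite (UNIV :: 'a set)"
  shows "\<Gamma> \<turnstile>\<^sub>M\<^sub>S \<phi> \<longleftrightarrow> umcomp_consequence TYPE('a) \<Gamma> \<phi>"
proof
  assume "\<Gamma> \<turnstile>\<^sub>M\<^sub>S \<phi>"
  then show "umcomp_consequence TYPE('a) \<Gamma> \<phi>"
    by (rule derives_sound)
next
  assume sem: "umcomp_consequence TYPE('a) \<Gamma> \<phi>"
  show "\<Gamma> \<turnstile>\<^sub>M\<^sub>S \<phi>"
  proof (rule ccontr)
    assume nd: "\<not> \<Gamma> \<turnstile>\<^sub>M\<^sub>S \<phi>"
    \<comment> \<open>\<open>\<Gamma>\<close> may use every variable; doubling the indices frees the odd ones for witnesses.\<close>
    let ?f = "\<lambda>n :: nat. 2 * n"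
    let ?G = "map_form ?f ` \<Gamma>"
    have "\<not> ?G \<turnstile>\<^sub>M\<^sub>S map_form ?f \<phi>"
      using nd derives_unrename[of "\<lambda>n. n div 2" ?f \<Gamma> \<phi>] by (auto simp: fun_eq_iff)
    then have "\<not> ?G \<turnstile>\<^sub>M\<^sub>S All (map_form ?f \<phi>)"
      using normal_theory.all_elim[OF normal_theory_derives] by blast
    moreover have "infinite (- \<Union>(vars ` ?G))"
    proof (rule infinite_super)
      show "range (\<lambda>n. 2 * n + 1) \<subseteq> - \<Union>(vars ` ?G)"
        by (auto simp: form.set_map) presburger
      show "infinite (range (\<lambda>n :: nat. 2 * n + 1))"
        using finite_imageD[of "\<lambda>n :: nat. 2 * n + 1" UNIV] by (auto simp: inj_def)
    qed
    ultimately obtain P where P: "saturated_theory P" "\<And>\<gamma>. \<gamma> \<in> \<Gamma> \<Longrightarrow> P (map_form ?f \<gamma>)"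
      "\<not> P (map_form ?f \<phi>)"
      using saturated_extension by blast
    obtain h :: "fm \<Rightarrow> 'a" where h: "\<And>a b. h a = h b \<longleftrightarrow> P (a \<^bold>\<leftrightarrow> b)"
      using ex_representatives[OF assms, of P] P(1) unfolding saturated_theory_def by blast
    interpret lindenbaum_algebra P h "lindenbaum P h"
      using P(1) h by (simp add: lindenbaum_algebra_def lindenbaum_algebra_axioms_def)
    have top: "h a = h Top \<longleftrightarrow> P a" for a
      unfolding h_eq by (rule iffI; erule prop1; simp)
    let ?v = "\<lambda>n. h (Var (?f n))"
    have "\<forall>\<gamma>\<in>\<Gamma>. eval_fm (lindenbaum P h) ?v \<gamma> = \<top>\<^bsub>lindenbaum P h\<^esub>"
      using P(2) by (simp add: eval_h top_h top)
    moreover have "range ?v \<subseteq> carrier (lindenbaum P h)"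
      by auto
    ultimately have "eval_fm (lindenbaum P h) ?v \<phi> = \<top>\<^bsub>lindenbaum P h\<^esub>"
      using sem umcomp_L unfolding umcomp_consequence_def by blast
    then show False
      using P(3) by (simp add: eval_h top_h top)
  qed
qed

end
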